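(* Let $G=(V,E)$ be a graph on $n$ vertices with minimum degree $m$, where $m\to\infty$ as $n\to\infty$. For every $\varepsilon>0$ there exists a constant $k_\varepsilon$ such that if $k\geq k_\varepsilon$ then with high probability $G_k$ contains a cycle of length at least $(1-\varepsilon)m$.
   Context: For a fixed graph $G=(V,E)$ and a positive integer $k$, the random graph $G_k$ is obtained by letting each vertex $v\in V$ independently choose $k$ random neighbors of $v$ in $G$ (uniformly from its $G$-neighborhood), the edges of $G_k$ being all pairs $\{v,w\}$ such that $v$ chose $w$ or $w$ chose $v$. $G$ is one member of a sequence of graphs with $n\to\infty$; "with high probability" means with probability tending to $1$ as $n\to\infty$ (equivalently, as $m\to\infty$). *)

theory Defs
  imports "HOL-Probability.Probability"
begin

definition simple_graph :: "'a set \<Rightarrow> ('a \<Rightarrow> 'a \<Rightarrow> bool) \<Rightarrow> bool" where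
  "simple_graph V E \<longleftrightarrow> finite V \<and> (\<forall>x y. E x y \<longrightarrow> x \<in> V \<and> y \<in> V)
     \<and> (\<forall>x y. E x y \<longrightarrow> E y x) \<and> (\<forall>x. \<not> E x x)"

definition nbrs :: "('a \<Rightarrow> 'a \<Rightarrow> bool) \<Rightarrow> 'a \<Rightarrow> 'a set" where
  "nbrs E v = {w. E v w}"

definition min_degree :: "'a set \<Rightarrow> ('a \<Rightarrow> 'a \<Rightarrow> bool) \<Rightarrow> nat" where
  "min_degree V E = Min ((\<lambda>v. card (nbrs E v)) ` V)"

definition choose_k :: "('a \<Rightarrow> 'a \<Rightarrow> bool) \<Rightarrow> nat \<Rightarrow> 'a \<Rightarrow> 'a set pmf" where
  "choose_k E k v = (if k \<le> card (nbrs E v)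
      then pmf_of_set {S. S \<subseteq> nbrs E v \<and> card S = k}
      else return_pmf (nbrs E v))"

definition k_out :: "'a set \<Rightarrow> ('a \<Rightarrow> 'a \<Rightarrow> bool) \<Rightarrow> nat \<Rightarrow> ('a \<Rightarrow> 'a \<Rightarrow> bool) pmf" where
  "k_out V E k = map_pmf (\<lambda>c x y. x \<in> V \<and> y \<in> V \<and> (y \<in> c x \<or> x \<in> c y))
                          (Pi_pmf V {} (\<lambda>v. choose_k E k v))"

definition has_cycle_len_ge :: "('a \<Rightarrow> 'a \<Rightarrow> bool) \<Rightarrow> real \<Rightarrow> bool" where
  "has_cycle_len_ge H L \<longleftrightarrow> (\<exists>xs. distinct xs \<and> length xs \<ge> 3 \<and> real (length xs) \<ge> L \<and>
      (\<forall>i<length xs. H (xs ! i) (xs ! ((i + 1) mod length xs))))"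

end

theory Submission
  imports Defs
begin

text \<open>A depth-first search forest of the random graph \<open>H\<close> makes the ends of every edge of \<open>H\<close>
  comparable. A union bound over all forests, weighted by the probability that their edges are
  chosen, shows that with high probability no forest \<open>F\<close> in \<open>H\<close> admits sets \<open>Y v\<close> of
  neighbours, each one of boundedly many sets determined by \<open>F\<close>, such that every \<open>v\<close> misses
  \<open>Y v\<close> although the fractions \<open>card (Y v) / deg v\<close> add up to \<open>\<delta> n\<close>: there are
  \<open>exp (O (n log k))\<close> weighted forests, and each of them fails with probability \<open>exp (- \<delta> k n)\<close>.

  So in the search forest all but few vertices have almost all of their graph neighbours comparable
  to them, and choose a neighbour in every large set of this kind. If there is no long cycle, these
  neighbours are within distance \<open>l = (1 - \<epsilon>) m\<close>. As there are fewer than \<open>l\<close> ancestors within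
  this distance, most vertices have at least order \<open>\<epsilon> m\<close> descendants, hence height at least \<open>l\<close>, and
  hence, on average, hardly more than \<open>l\<close> descendants within distance \<open>l\<close>. On a chain of
  typical vertices, the number of neighbours among the near ancestors cannot keep increasing, so
  some vertex \<open>v\<close> has almost as many of them as its parent \<open>u\<close>. A far upward chord at \<open>v\<close> and a
  far downward chord at \<open>u\<close> then close a cycle of length nearly \<open>m\<close> with the forest, following
  the idea of Riordan's proof for random subgraphs with independent edges.\<close>

section \<open>Rooted forests and depth-first search\<close>

primrec ancestor :: "('a \<Rightarrow> 'a option) \<Rightarrow> nat \<Rightarrow> 'a \<Rightarrow> 'a option" where
  "ancestor p 0 x = Some x"
| "ancestor p (Suc j) x = Option.bind (ancestor p j x) p"

lemma ancestor_add:
  "ancestor p (i + j) x = Option.bind (ancestor p i x) (ancestor p j)"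
proof (induction j)
  case 0
  thus ?case by (cases "ancestor p i x") auto
next
  case (Suc j)
  thus ?case by (cases "ancestor p i x") auto
qed

lemma ancestor_add_Some: "ancestor p i x = Some y \<Longrightarrow> ancestor p (i + j) x = ancestor p j y"
  by (simp add: ancestor_add)

lemma ancestor_Suc_Some: "p x = Some y \<Longrightarrow> ancestor p (Suc j) x = ancestor p j y"
  using ancestor_add[of p 1 j x] by simp

lemma ancestor_le_Some:
  assumes "ancestor p j x = Some y" "i \<le> j"
  obtains z where "ancestor p i x = Some z" "ancestor p (j - i) z = Some y"
proof -
  have "Option.bind (ancestor p i x) (ancestor p (j - i)) = Some y"
    using assms ancestor_add[of p i "j - i" x] by simp
  thus ?thesis using that by (auto simp: bind_eq_Some_conv)
qed

text \<open>A walk that starts in \<open>W\<close> stays in \<open>W\<close>, so it never consults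
  the new value at \<open>u\<close>. Thus a search can attach a fresh vertex without disturbing the
  ancestors of old ones.\<close>

lemma ancestor_fun_upd:
  assumes closed: "\<And>x y. p x = Some y \<Longrightarrow> y \<in> W" and "u \<notin> W" "x \<in> W"
  shows "ancestor (p(u := q)) j x = ancestor p j x"
proof -
  have "ancestor (p(u := q)) j x = ancestor p j x \<and> (\<forall>y. ancestor p j x = Some y \<longrightarrow> y \<in> W)"
  proof (induction j)
    case 0
    then show ?case using assms by simp
  next
    case (Suc j)
    then show ?case using closed \<open>u \<notin> W\<close>
      by (cases "ancestor p j x") auto
  qed
  thus ?thesis by blast
qed

text \<open>\<open>depth\<close> certifies acyclicity: it grows by one from parent to child. Roots
  may have any depth. Comparing depths also yields the disjointness and distinctness facts
  below.\<close>

locale rooted_forest =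
  fixes V :: "'a set" and p :: "'a \<Rightarrow> 'a option" and depth :: "'a \<Rightarrow> nat"
  assumes finite_V: "finite V"
    and parent: "p x = Some y \<Longrightarrow> x \<in> V \<and> y \<in> V \<and> depth x = Suc (depth y)"
begin

lemma ancestor_depth: "ancestor p j x = Some y \<Longrightarrow> depth x = depth y + j"
proof (induction j arbitrary: y)
  case (Suc j)
  then obtain z where "ancestor p j x = Some z" "p z = Some y"
    by (auto simp: bind_eq_Some_conv)
  thus ?case using Suc.IH parent by fastforce
qed simp

lemma descendant_in: "ancestor p j x = Some y \<Longrightarrow> y \<in> V \<Longrightarrow> x \<in> V"
proof (cases j)
  case (Suc i)
  assume "ancestor p j x = Some y"
  then obtain z where "ancestor p 1 x = Some z"
    using Suc ancestor_le_Some[of p j x y 1] by auto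
  thus "x \<in> V" by (auto dest: parent)
qed simp

section \<open>Counting descendants by distance\<close>

definition desc :: "nat \<Rightarrow> 'a \<Rightarrow> 'a set" where
  "desc j w = {v. ancestor p j v = Some w}"

lemma desc_subset: "w \<in> V \<Longrightarrow> desc j w \<subseteq> V"
  by (auto simp: desc_def dest: descendant_in)

lemma finite_desc: "w \<in> V \<Longrightarrow> finite (desc j w)"
  using desc_subset finite_V finite_subset by metis

lemma desc_disjoint: "i \<noteq> j \<Longrightarrow> desc i w \<inter> desc j w = {}"
  by (auto simp: desc_def dest!: ancestor_depth)

lemma desc_disjoint': "w \<noteq> w' \<Longrightarrow> desc j w \<inter> desc j w' = {}"
  by (auto simp: desc_def)

lemma desc_nonempty_le: "desc j w \<noteq> {} \<Longrightarrow> i \<le> j \<Longrightarrow> desc i w \<noteq> {}"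
proof -
  assume "desc j w \<noteq> {}" "i \<le> j"
  then obtain v where "ancestor p j v = Some w" by (auto simp: desc_def)
  then obtain z where "ancestor p (j - (j - i)) z = Some w"
    using ancestor_le_Some[of p j v w "j - i"] by auto
  thus ?thesis using \<open>i \<le> j\<close> by (auto simp: desc_def)
qed

text \<open>A vertex has at most one ancestor at distance \<open>j\<close>, so the sets
  \<open>desc j w\<close> are disjoint for distinct \<open>w\<close>.\<close>

lemma sum_card_desc: "(\<Sum>w\<in>V. card (desc j w)) \<le> card V"
proof -
  have "(\<Sum>w\<in>V. card (desc j w)) = card (\<Union>w\<in>V. desc j w)"
    using finite_V finite_desc desc_disjoint' by (subst card_UN_disjoint) auto
  also have "\<dots> \<le> card V"
    using desc_subset finite_V by (intro card_mono) auto
  finally show ?thesis .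
qed

definition near_desc :: "nat \<Rightarrow> 'a \<Rightarrow> 'a set" where
  "near_desc l w = (\<Union>j<l. desc j w)"

lemma near_desc_subset: "w \<in> V \<Longrightarrow> near_desc l w \<subseteq> V"
  using desc_subset by (auto simp: near_desc_def)

lemma finite_near_desc: "w \<in> V \<Longrightarrow> finite (near_desc l w)"
  using near_desc_subset finite_V finite_subset by metis

lemma card_near_desc: "w \<in> V \<Longrightarrow> card (near_desc l w) = (\<Sum>j<l. card (desc j w))"
  unfolding near_desc_def using finite_desc desc_disjoint
  by (subst card_UN_disjoint) auto

lemma sum_card_near_desc: "(\<Sum>w\<in>V. card (near_desc l w)) \<le> l * card V"
proof -
  have "(\<Sum>w\<in>V. card (near_desc l w)) = (\<Sum>j<l. \<Sum>w\<in>V. card (desc j w))"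
    by (subst sum.swap) (simp add: card_near_desc)
  also have "\<dots> \<le> (\<Sum>j<l. card V)" by (intro sum_mono sum_card_desc)
  finally show ?thesis by simp
qed

text \<open>These are the vertices of height less than \<open>l\<close>.\<close>

definition low :: "nat \<Rightarrow> 'a set" where
  "low l = {w \<in> V. desc l w = {}}"

lemma not_low_desc: "w \<in> V - low l \<Longrightarrow> j \<le> l \<Longrightarrow> desc j w \<noteq> {}"
  using desc_nonempty_le by (auto simp: low_def)

lemma card_desc_ge_1: "w \<in> V - low l \<Longrightarrow> j \<le> l \<Longrightarrow> 1 \<le> card (desc j w)"
  using not_low_desc finite_desc by (metis DiffD1 One_nat_def Suc_leI card_gt_0_iff)

lemma card_near_desc_ge: "w \<in> V - low l \<Longrightarrow> j \<le> Suc l \<Longrightarrow> j \<le> card (near_desc j w)"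
proof -
  assume w: "w \<in> V - low l" and "j \<le> Suc l"
  have "(\<Sum>i<j. 1) \<le> (\<Sum>i<j. card (desc i w))"
    using w \<open>j \<le> Suc l\<close> by (intro sum_mono card_desc_ge_1) auto
  thus ?thesis using w by (simp add: card_near_desc)
qed

definition heavy :: "nat \<Rightarrow> real \<Rightarrow> 'a set" where
  "heavy l \<eta> = {w \<in> V - low l. real (card (near_desc l w)) > (1 + \<eta>) * l}"

text \<open>Markov's inequality for the excess \<open>card (near_desc l w) - l\<close>, which is
  nonnegative off \<open>low l\<close> because there each of the first \<open>l\<close> levels is
  inhabited. By double counting, the total excess off \<open>low l\<close> is at most
  \<open>l * card (low l)\<close>.\<close>

lemma card_heavy:
  assumes "l > 0"
  shows "\<eta> * real (card (heavy l \<eta>)) \<le> real (card (low l))"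
proof -
  let ?L = "low l" and ?H = "heavy l \<eta>"
  have fin: "finite ?L" "finite ?H" using finite_V by (auto simp: low_def heavy_def)
  have H: "?H \<subseteq> V - ?L" by (auto simp: heavy_def)
  have "\<eta> * l * card ?H = (\<Sum>w\<in>?H. \<eta> * l)" by simp
  also have "\<dots> \<le> (\<Sum>w\<in>?H. real (card (near_desc l w)) - l)"
    by (intro sum_mono) (auto simp: heavy_def algebra_simps)
  also have "\<dots> \<le> (\<Sum>w\<in>V - ?L. real (card (near_desc l w)) - l)"
    using H finite_V card_near_desc_ge[of _ l l] by (intro sum_mono2) auto
  also have "\<dots> = (\<Sum>w\<in>V - ?L. real (card (near_desc l w))) - l * card (V - ?L)"
    by (simp add: sum_subtractf)
  also have "\<dots> \<le> (\<Sum>w\<in>V. real (card (near_desc l w))) - l * card (V - ?L)"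
    using finite_V by (intro diff_right_mono sum_mono2) auto
  also have "\<dots> \<le> real l * real (card V) - l * card (V - ?L)"
  proof (intro diff_right_mono)
    show "(\<Sum>w\<in>V. real (card (near_desc l w))) \<le> real l * real (card V)"
      using of_nat_mono[OF sum_card_near_desc[of l], where 'a = real] by simp
  qed
  also have "\<dots> = l * card ?L"
  proof -
    have "card V = card ?L + card (V - ?L)"
      using finite_V by (metis (no_types, lifting) card_Int_Diff Int_absorb1 low_def mem_Collect_eq subsetI)
    thus ?thesis by (simp add: algebra_simps)
  qed
  finally have "l * (\<eta> * card ?H) \<le> l * real (card ?L)" by (simp add: mult.left_commute mult.commute)
  thus ?thesis using \<open>l > 0\<close> by simp
qed

definition all_desc :: "'a \<Rightarrow> 'a set" where
  "all_desc w = (\<Union>j. desc j w)"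

lemma all_desc_subset: "w \<in> V \<Longrightarrow> all_desc w \<subseteq> V"
  using desc_subset by (auto simp: all_desc_def)

lemma mem_all_desc_self: "w \<in> all_desc w"
  unfolding all_desc_def desc_def by (auto intro: exI[of _ 0])

definition poor :: "nat \<Rightarrow> 'a set" where
  "poor s = {w \<in> V. card (all_desc w) \<le> s}"

text \<open>The minimal rich vertices have disjoint sets of descendants, all of them poor, and every
  rich vertex of small height is a close ancestor of one of them.\<close>
lemma card_low:
  "s * card (low l) \<le> s * card (poor s) + l * card (poor s)"
proof -
  define Q where "Q = {q \<in> V - poor s. all_desc q - {q} \<subseteq> poor s}"
  have fin: "finite Q" "finite (poor s)" using finite_V by (auto simp: Q_def poor_def)
  have disj: "(all_desc q - {q}) \<inter> (all_desc q' - {q'}) = {}"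
    if "q \<in> Q" "q' \<in> Q" "q \<noteq> q'" for q q'
  proof (rule ccontr)
    \<comment> \<open>Two ancestors of \<open>x\<close> lie on one upward path, so \<open>a\<close>
      would be a rich proper descendant of \<open>b\<close>, against the minimality of
      \<open>b\<close>.\<close>
    have key: False if "a \<in> Q" "b \<in> Q" "a \<noteq> b" "i \<le> j"
      "ancestor p i x = Some a" "ancestor p j x = Some b" for a b i j x
    proof -
      have "ancestor p (j - i) a = Some b"
        using that ancestor_add_Some[of p i x a "j - i"] by simp
      hence "a \<in> all_desc b - {b}" using that by (auto simp: all_desc_def desc_def)
      thus False using that by (auto simp: Q_def)
    qed
    assume "(all_desc q - {q}) \<inter> (all_desc q' - {q'}) \<noteq> {}"
    then obtain x i j where "ancestor p i x = Some q" "ancestor p j x = Some q'"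
      by (auto simp: all_desc_def desc_def)
    thus False using key[of q q' i j x] key[of q' q j i x] that by (cases "i \<le> j") auto
  qed
  have "s * card Q = (\<Sum>q\<in>Q. s)" by simp
  also have "\<dots> \<le> (\<Sum>q\<in>Q. card (all_desc q - {q}))"
  proof (intro sum_mono)
    fix q assume "q \<in> Q"
    hence "q \<in> V" "card (all_desc q) > s" by (auto simp: Q_def poor_def)
    thus "s \<le> card (all_desc q - {q})"
      using mem_all_desc_self[of q] by simp
  qed
  also have "\<dots> = card (\<Union>q\<in>Q. all_desc q - {q})"
  proof (subst card_UN_disjoint)
    show "\<forall>q\<in>Q. finite (all_desc q - {q})"
      using all_desc_subset finite_V by (auto simp: Q_def intro: finite_subset)
  qed (use fin disj in auto)
  also have "\<dots> \<le> card (poor s)" using fin by (intro card_mono) (auto simp: Q_def)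
  finally have Q: "s * card Q \<le> card (poor s)" .
  have sub: "low l - poor s \<subseteq> (\<Union>q\<in>Q. \<Union>j<l. set_option (ancestor p j q))"
  proof
    fix w assume w: "w \<in> low l - poor s"
    hence wV: "w \<in> V" by (auto simp: low_def)
    \<comment> \<open>A rich descendant at maximal distance from \<open>w\<close> has only poor
      proper descendants. The small height of \<open>w\<close> keeps this distance below
      \<open>l\<close>.\<close>
    define J where "J = {j. \<exists>q\<in>V - poor s. ancestor p j q = Some w}"
    have J: "j < l" if "j \<in> J" for j
    proof (rule ccontr)
      assume "\<not> j < l"
      moreover have "desc j w \<noteq> {}" using that by (auto simp: J_def desc_def)
      ultimately have "desc l w \<noteq> {}" using desc_nonempty_le by (meson not_le_imp_less)
      thus False using w by (auto simp: low_def)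
    qed
    have "0 \<in> J" using w wV by (auto simp: J_def)
    moreover have finJ: "finite J" using J by (meson finite_nat_iff_bounded lessThan_iff subsetI)
    ultimately have "Max J \<in> J" by (intro Max_in) auto
    then obtain q where q: "q \<in> V - poor s" "ancestor p (Max J) q = Some w"
      by (auto simp: J_def)
    have "all_desc q - {q} \<subseteq> poor s"
    proof (rule ccontr)
      assume "\<not> ?thesis"
      then obtain x i where x: "ancestor p i x = Some q" "x \<noteq> q" "x \<notin> poor s"
        by (auto simp: all_desc_def desc_def)
      have "x \<in> V" using x q descendant_in by auto
      hence "i + Max J \<in> J" using x q ancestor_add_Some[of p i x q "Max J"] by (auto simp: J_def)
      hence "i + Max J \<le> Max J" using finJ Max_ge by blast
      hence "i = 0" by simp
      thus False using x by simp
    qed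
    hence "q \<in> Q" using q by (auto simp: Q_def)
    thus "w \<in> (\<Union>q\<in>Q. \<Union>j<l. set_option (ancestor p j q))"
      using q J \<open>Max J \<in> J\<close> by auto
  qed
  have "card (low l - poor s) \<le> card (\<Union>q\<in>Q. \<Union>j<l. set_option (ancestor p j q))"
    using fin sub by (intro card_mono) auto
  also have "\<dots> \<le> (\<Sum>q\<in>Q. \<Sum>j<l. card (set_option (ancestor p j q)))"
    using fin by (intro order_trans[OF card_UN_le] sum_mono card_UN_le) auto
  also have "\<dots> \<le> (\<Sum>q\<in>Q. \<Sum>j<l. 1)"
  proof (intro sum_mono)
    fix q j show "card (set_option (ancestor p j q)) \<le> 1"
      by (cases "ancestor p j q") auto
  qed
  finally have LP: "card (low l - poor s) \<le> l * card Q" by (simp add: mult.commute)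
  have "card (low l) \<le> card ((low l - poor s) \<union> poor s)"
    using fin finite_V by (intro card_mono) (auto simp: low_def)
  also have "\<dots> \<le> card (low l - poor s) + card (poor s)" by (rule card_Un_le)
  also have "\<dots> \<le> l * card Q + card (poor s)" using LP by simp
  finally have "s * card (low l) \<le> s * (l * card Q + card (poor s))" by (rule mult_le_mono2)
  also have "\<dots> = s * card (poor s) + l * (s * card Q)" by (simp add: algebra_simps)
  also have "\<dots> \<le> s * card (poor s) + l * card (poor s)" using Q by simp
  finally show ?thesis .
qed

text \<open>For each \<open>j \<le> t\<close>, the vertices outside \<open>B\<close> have disjoint
  nonempty sets of descendants at distance \<open>j\<close>, so at most \<open>card B\<close>
  vertices lack a \<open>j\<close>-th ancestor outside \<open>B\<close>. A union bound over the
  \<open>Suc t\<close> values of \<open>j\<close> leaves some \<open>v\<close>.\<close>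

lemma ex_chain_avoiding:
  assumes B: "low l \<subseteq> B" "B \<subseteq> V" and "t \<le> l" and small: "Suc t * card B < card V"
  shows "\<exists>v. \<forall>j\<le>t. \<exists>w\<in>V - B. ancestor p j v = Some w"
proof -
  define C where "C j = (\<Union>w\<in>V - B. desc j w)" for j
  have CV: "C j \<subseteq> V" for j using desc_subset by (auto simp: C_def)
  have fB: "finite B" using B finite_V finite_subset by metis
  have C: "card (V - C j) \<le> card B" if "j \<le> t" for j
  proof -
    have "card (V - B) = (\<Sum>w\<in>V - B. 1)" by simp
    also have "\<dots> \<le> (\<Sum>w\<in>V - B. card (desc j w))"
      using B that \<open>t \<le> l\<close> by (intro sum_mono card_desc_ge_1[where l = l]) auto
    also have "\<dots> = card (C j)" unfolding C_def
      using finite_V finite_desc desc_disjoint' by (subst card_UN_disjoint) auto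
    finally have "card (V - B) \<le> card (C j)" .
    moreover have "card (V - B) = card V - card B"
      using fB B by (simp add: card_Diff_subset)
    moreover have "card (V - C j) = card V - card (C j)"
      using CV finite_V by (meson card_Diff_subset finite_subset)
    moreover have "card B \<le> card V" using B finite_V card_mono by auto
    ultimately show ?thesis by linarith
  qed
  have "card (\<Union>j\<le>t. V - C j) \<le> (\<Sum>j\<le>t. card (V - C j))" by (intro card_UN_le) auto
  also have "\<dots> \<le> (\<Sum>j\<le>t. card B)" by (intro sum_mono C) auto
  also have "\<dots> < card V" using small by simp
  finally have "\<not> V \<subseteq> (\<Union>j\<le>t. V - C j)"
    using finite_V by (metis (no_types, lifting) card_mono finite_Diff finite_UN finite_atMost leD)
  then obtain v where "v \<in> V" "\<forall>j\<le>t. v \<in> C j" by blast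
  thus ?thesis by (auto simp: C_def desc_def intro!: exI[of _ v])
qed

end

section \<open>Depth-first search\<close>

lemma ex_normal_forest:
  fixes H :: "'a \<Rightarrow> 'a \<Rightarrow> bool"
  assumes "finite V" and sym: "\<And>x y. H x y \<Longrightarrow> H y x" and irr: "\<And>x. \<not> H x x"
  shows "\<exists>p depth. rooted_forest V p depth \<and> (\<forall>x y. p x = Some y \<longrightarrow> H x y) \<and>
    (\<forall>x\<in>V. \<forall>y\<in>V. H x y \<longrightarrow> (\<exists>j. ancestor p j x = Some y \<or> ancestor p j y = Some x))"
proof -
  text \<open>Depth-first search: the visited vertices that still have unvisited neighbours lie on the
    chain of ancestors of the current vertex \<open>t\<close>.\<close>
  have "\<exists>W p depth t. W \<subseteq> V \<and> card W = n \<and> rooted_forest W p depth \<and> (\<forall>x y. p x = Some y \<longrightarrow> H x y) \<and>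
    (\<forall>x\<in>W. \<forall>y\<in>W. H x y \<longrightarrow> (\<exists>j. ancestor p j x = Some y \<or> ancestor p j y = Some x)) \<and>
    (\<forall>w\<in>W. (\<exists>u\<in>V - W. H w u) \<longrightarrow> (\<exists>i. ancestor p i t = Some w))" if "n \<le> card V" for n
    using that
  proof (induction n)
    case 0
    show ?case
      by (rule exI[of _ "{}"], rule exI[of _ "\<lambda>_. None"]) (auto simp: rooted_forest_def)
  next
    case (Suc n)
    from Suc.IH[OF Suc_leD[OF Suc.prems]]
    obtain W p depth t where W: "W \<subseteq> V" "card W = n" "rooted_forest W p depth"
      and pH: "\<forall>x y. p x = Some y \<longrightarrow> H x y"
      and cmp: "\<forall>x\<in>W. \<forall>y\<in>W. H x y \<longrightarrow> (\<exists>j. ancestor p j x = Some y \<or> ancestor p j y = Some x)"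
      and tip: "\<forall>w\<in>W. (\<exists>u\<in>V - W. H w u) \<longrightarrow> (\<exists>i. ancestor p i t = Some w)"
      by (elim exE conjE) (rule that)
    interpret rooted_forest W p depth by fact
    have par: "p x = Some y \<Longrightarrow> x \<in> W \<and> y \<in> W" for x y using parent by blast
    define Act where "Act = {w \<in> W. \<exists>u\<in>V - W. H w u}"
    \<comment> \<open>\<open>u\<close> is the next vertex to visit and \<open>q\<close> its parent,
      \<open>None\<close> for a new root. Every active vertex has to become an ancestor of
      \<open>u\<close>.\<close>
    obtain u q d where u: "u \<in> V - W" and q: "\<And>a. q = Some a \<Longrightarrow> a \<in> W \<and> H u a \<and> d = Suc (depth a)"
      and act: "\<And>w. w \<in> Act \<Longrightarrow> \<exists>a i. q = Some a \<and> ancestor p i a = Some w"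
    proof (cases "Act = {}")
      case True
      have "W \<noteq> V" using W(2) Suc.prems by auto
      then obtain u where "u \<in> V - W" using W by auto
      thus ?thesis using True by (intro that[of u None 0]) auto
    next
      case False
      let ?P = "\<lambda>i. \<exists>a\<in>Act. ancestor p i t = Some a"
      have ex: "\<exists>i. ?P i" using False tip by (fastforce simp: Act_def)
      \<comment> \<open>The first active vertex \<open>a\<close> on the way up from \<open>t\<close>
        is the right parent: the other active vertices lie further up, hence are ancestors of
        \<open>a\<close>.\<close>
      define i where "i = (LEAST i. ?P i)"
      obtain a where a: "a \<in> Act" "ancestor p i t = Some a"
        using LeastI_ex[OF ex] by (auto simp: i_def)
      then obtain u where u: "u \<in> V - W" "H a u" by (auto simp: Act_def)
      show ?thesis
      proof (rule that[of u "Some a" "Suc (depth a)"])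
        fix w assume w: "w \<in> Act"
        then obtain i' where i': "ancestor p i' t = Some w" using tip by (auto simp: Act_def)
        hence "i \<le> i'" unfolding i_def using w by (intro Least_le) auto
        hence "ancestor p (i' - i) a = Some w"
          using a i' ancestor_add_Some[of p i t a "i' - i"] by simp
        thus "\<exists>a' j. Some a = Some a' \<and> ancestor p j a' = Some w" by blast
      qed (use a u sym in \<open>auto simp: Act_def\<close>)
    qed
    define p' where "p' = p(u := q)"
    have anc: "ancestor p' j x = ancestor p j x" if "x \<in> W" for j x
      unfolding p'_def by (rule ancestor_fun_upd[where W = W]) (use par u that in auto)
    have act': "\<exists>i. ancestor p' i u = Some w" if "w \<in> Act" for w
    proof -
      obtain a i where ai: "q = Some a" "ancestor p i a = Some w" using act \<open>w \<in> Act\<close> by blast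
      hence "ancestor p' (Suc i) u = Some w"
        using q anc ancestor_Suc_Some[of p' u a i] by (auto simp: p'_def)
      thus ?thesis by blast
    qed
    have pu: "p u = None" using par u by (cases "p u") auto
    have "rooted_forest (insert u W) p' (depth(u := d))"
    proof
      show "finite (insert u W)" using finite_V by simp
      fix x y assume "p' x = Some y"
      thus "x \<in> insert u W \<and> y \<in> insert u W \<and> (depth(u := d)) x = Suc ((depth(u := d)) y)"
        using q[of y] u parent[of x y] by (cases "x = u") (auto simp: p'_def split: if_splits)
    qed
    moreover have "\<forall>x y. p' x = Some y \<longrightarrow> H x y" using pH q by (auto simp: p'_def)
    moreover have "\<exists>j. ancestor p' j x = Some y \<or> ancestor p' j y = Some x"
      if xy: "x \<in> insert u W" "y \<in> insert u W" "H x y" for x y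
    proof -
      consider "x \<in> W" "y \<in> W" | "x = u" "y \<in> W" | "y = u" "x \<in> W"
        using xy irr by blast
      thus ?thesis
      proof cases
        case 1
        thus ?thesis using cmp anc \<open>H x y\<close> by metis
      next
        case 2
        hence "y \<in> Act" using u sym \<open>H x y\<close> by (auto simp: Act_def)
        thus ?thesis using act' 2 by metis
      next
        case 3
        hence "x \<in> Act" using u \<open>H x y\<close> by (auto simp: Act_def)
        thus ?thesis using act' 3 by metis
      qed
    qed
    moreover have "\<exists>i. ancestor p' i u = Some w"
      if "w \<in> insert u W" "v \<in> V - insert u W" "H w v" for w v
    proof (cases "w = u")
      case True
      thus ?thesis by (intro exI[of _ 0]) simp
    next
      case False
      thus ?thesis using that by (intro act') (auto simp: Act_def)
    qed
    moreover have "card (insert u W) = Suc n" "insert u W \<subseteq> V"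
      using W u finite_V by auto
    ultimately show ?case
      by (intro exI[of _ "insert u W"] exI[of _ p'] exI[of _ "depth(u := d)"] exI[of _ u]) blast
  qed
  from this[OF order_refl] obtain W p depth where W: "W \<subseteq> V" "card W = card V"
    "rooted_forest W p depth \<and> (\<forall>x y. p x = Some y \<longrightarrow> H x y) \<and>
    (\<forall>x\<in>W. \<forall>y\<in>W. H x y \<longrightarrow> (\<exists>j. ancestor p j x = Some y \<or> ancestor p j y = Some x))"
    by auto
  have "W = V" using W \<open>finite V\<close> by (metis card_subset_eq)
  thus ?thesis using W by blast
qed

section \<open>A union bound over forests\<close>

lemma Suc_mult_choose_Suc: "Suc j * (n choose Suc j) = (n - j) * (n choose j)"
proof (cases n)
  case (Suc m)
  show ?thesis
    using Suc_times_binomial_eq[of m j] binomial_absorb_comp[of n j] Suc by (simp add: mult.commute)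
qed simp

text \<open>Factor by factor, \<open>(e - y - i) / (e - i) \<le> 1 - y / e \<le> 1 - y / d\<close>;
  cross-multiplied to stay within the naturals.\<close>

lemma choose_diff_mult_power_le:
  fixes e d y j :: nat
  assumes "e \<le> d"
  shows "((e - y) choose j) * d ^ j \<le> (e choose j) * (d - y) ^ j"
proof (induction j)
  case (Suc j)
  have *: "(e - y - j) * d \<le> (e - j) * (d - y)"
  proof (cases "y + j \<le> e")
    case True
    then obtain i where e: "e = y + j + i" by (auto simp: le_iff_add)
    obtain l where d: "d = e + l" using assms by (auto simp: le_iff_add)
    show ?thesis by (simp add: e d algebra_simps)
  qed simp
  have "Suc j * (((e - y) choose Suc j) * d ^ Suc j) = ((e - y - j) * d) * (((e - y) choose j) * d ^ j)"
    by (simp only: mult.assoc[symmetric] Suc_mult_choose_Suc power_Suc) (simp only: mult_ac)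
  also have "\<dots> \<le> ((e - j) * (d - y)) * ((e choose j) * (d - y) ^ j)"
    using * Suc.IH by (rule mult_le_mono)
  also have "\<dots> = Suc j * ((e choose Suc j) * (d - y) ^ Suc j)"
    by (simp only: mult.assoc[symmetric] Suc_mult_choose_Suc power_Suc) (simp only: mult_ac)
  finally show ?case by (simp only: Suc_mult_le_cancel1)
qed simp

text \<open>The quotient of the binomials is the product of \<open>(k - i) / (d - i)\<close> over
  \<open>i < b\<close>, and each factor is at most \<open>k / d\<close>.\<close>

lemma choose_diff_diff_mult_power_le:
  fixes d k b :: nat
  assumes "b \<le> k" "k \<le> d"
  shows "((d - b) choose (k - b)) * d ^ b \<le> (d choose k) * k ^ b"
  using assms
proof (induction b)
  case (Suc b)
  obtain d' where d': "d - b = Suc d'" using Suc.prems by (cases "d - b") auto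
  obtain k' where k': "k - b = Suc k'" using Suc.prems by (cases "k - b") auto
  have *: "(k - b) * d \<le> (d - b) * k"
    using Suc.prems by (simp add: diff_mult_distrib mult.commute[of d] diff_le_mono2)
  have "(d - b) * (((d - Suc b) choose (k - Suc b)) * d ^ Suc b) = (Suc d' * (d' choose k')) * d ^ b * d"
    using d' k' by (simp add: Suc_diff_Suc diff_Suc algebra_simps)
  also have "\<dots> = ((k - b) * d) * (((d - b) choose (k - b)) * d ^ b)"
    by (simp only: Suc_times_binomial_eq d' k' mult_ac)
  also have "\<dots> \<le> ((d - b) * k) * ((d choose k) * k ^ b)"
    using Suc by (intro mult_le_mono[OF *] Suc.IH) auto
  also have "\<dots> = (d - b) * ((d choose k) * k ^ Suc b)" by (simp add: mult_ac)
  finally show ?case using d' by (simp only: Suc_mult_le_cancel1)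
qed simp

text \<open>A favourable set is \<open>B\<close> together with a \<open>(k - b)\<close>-subset of
  \<open>N - B - Y\<close>, and the two preceding estimates bound their number. One factor
  \<open>exp 1\<close> per element of \<open>B\<close> pays for having \<open>k\<close> instead of
  \<open>k - b\<close> in the exponent, as \<open>y / d \<le> 1\<close>.\<close>

lemma prob_subset_contains_avoids:
  fixes N B Y :: "'a set"
  assumes "finite N" "0 < k" "k \<le> card N"
  defines "d \<equiv> real (card N)"
  shows "measure_pmf.prob (pmf_of_set {S. S \<subseteq> N \<and> card S = k}) {S. B \<subseteq> S \<and> S \<inter> Y = {}}
    \<le> (exp 1 * k / d) ^ card B * exp (- k * (card (Y \<inter> N) / d))"
proof -
  let ?O = "{S. S \<subseteq> N \<and> card S = k}" and ?A = "{S. B \<subseteq> S \<and> S \<inter> Y = {}}"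
  define b where "b = card B"
  define y where "y = card (Y \<inter> N)"
  have d: "d > 0" using assms by (simp add: d_def)
  have yd: "real y / d \<le> 1" "y \<le> card N"
    using assms d by (auto simp: y_def d_def intro!: card_mono)
  have cO: "card ?O = card N choose k" using n_subsets[OF \<open>finite N\<close>] by simp
  have pos: "(card N choose k) > 0" using assms by simp
  have O: "?O \<noteq> {}" "finite ?O" using cO pos by (metis card.empty less_irrefl, metis card.infinite less_irrefl)
  have prob: "measure_pmf.prob (pmf_of_set ?O) ?A = card (?O \<inter> ?A) / (card N choose k)"
    using O by (simp add: measure_pmf_of_set cO)
  show ?thesis
  proof (cases "?O \<inter> ?A = {}")
    case True
    show ?thesis unfolding prob True using d by (simp add: zero_le_mult_iff)
  next
    case False
    then obtain S where S: "S \<subseteq> N" "card S = k" "B \<subseteq> S" "S \<inter> Y = {}" by blast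
    have fin: "finite S" "finite B" using S \<open>finite N\<close> finite_subset by metis+
    have bk: "b \<le> k" using S fin card_mono by (auto simp: b_def)
    have BN: "B \<subseteq> N" "B \<inter> Y = {}" using S by auto
    let ?T = "{T. T \<subseteq> N - B - Y \<and> card T = k - b}"
    have "?O \<inter> ?A \<subseteq> (\<lambda>T. B \<union> T) ` ?T"
    proof
      fix S assume "S \<in> ?O \<inter> ?A"
      hence S: "S \<subseteq> N" "card S = k" "B \<subseteq> S" "S \<inter> Y = {}" by auto
      hence "S - B \<in> ?T" using fin by (auto simp: card_Diff_subset b_def)
      moreover have "S = B \<union> (S - B)" using S by auto
      ultimately show "S \<in> (\<lambda>T. B \<union> T) ` ?T" by blast
    qed
    hence "card (?O \<inter> ?A) \<le> card ?T"
      using \<open>finite N\<close> by (intro surj_card_le) auto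
    also have "\<dots> = card (N - B - Y) choose (k - b)" using \<open>finite N\<close> by (intro n_subsets) auto
    also have "card (N - B - Y) = card N - b - y"
    proof -
      have "N - B - Y = N - (B \<union> (Y \<inter> N))" by auto
      moreover have "card (B \<union> (Y \<inter> N)) = b + y"
        using fin BN \<open>finite N\<close> unfolding b_def y_def by (intro card_Un_disjoint) auto
      ultimately show ?thesis using fin BN \<open>finite N\<close>
        by (simp add: card_Diff_subset)
    qed
    finally have c1: "card (?O \<inter> ?A) \<le> (card N - b - y) choose (k - b)" .
    have "card (?O \<inter> ?A) * card N ^ k \<le> ((card N - b - y) choose (k - b)) * card N ^ (k - b) * card N ^ b"
      using c1 bk unfolding mult.assoc power_add[symmetric] by simp
    also have "\<dots> \<le> ((card N - b) choose (k - b)) * (card N - y) ^ (k - b) * card N ^ b"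
      by (intro mult_le_mono choose_diff_mult_power_le) auto
    also have "\<dots> = (((card N - b) choose (k - b)) * card N ^ b) * (card N - y) ^ (k - b)" by simp
    also have "\<dots> \<le> ((card N choose k) * k ^ b) * (card N - y) ^ (k - b)"
      using bk assms by (intro mult_le_mono choose_diff_diff_mult_power_le) auto
    finally have "real (card (?O \<inter> ?A) * card N ^ k)
        \<le> real (((card N choose k) * k ^ b) * (card N - y) ^ (k - b))" by (rule of_nat_mono)
    hence c2: "real (card (?O \<inter> ?A)) * d ^ k \<le> real (card N choose k) * (k ^ b * (d - y) ^ (k - b))"
      using yd by (simp add: d_def of_nat_diff mult_ac)
    have "d ^ k = d ^ b * d ^ (k - b)" using bk by (simp add: power_add[symmetric])
    moreover have "1 - y / d = (d - y) / d" using d by (simp add: diff_divide_distrib)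
    ultimately have c3: "(k ^ b * (d - y) ^ (k - b)) / d ^ k = (k / d) ^ b * (1 - y / d) ^ (k - b)"
      by (simp add: power_divide)
    have "card (?O \<inter> ?A) / (card N choose k) \<le> (k ^ b * (d - y) ^ (k - b)) / d ^ k"
      using c2 d pos by (simp add: field_simps)
    also have "\<dots> = (k / d) ^ b * (1 - y / d) ^ (k - b)" by (rule c3)
    also have "\<dots> \<le> (k / d) ^ b * exp (- (y / d)) ^ (k - b)"
      using yd d exp_ge_add_one_self[of "- (y / d)"] by (intro mult_left_mono power_mono) auto
    also have "exp (- (y / d)) ^ (k - b) = exp (- real k * (y / d)) * exp (b * (y / d))"
      using bk by (simp add: exp_of_nat_mult[symmetric] mult_exp_exp of_nat_diff algebra_simps)
    also have "\<dots> \<le> exp (- real k * (y / d)) * exp (b * 1)"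
      using mult_left_mono[OF yd(1), of b] by (intro mult_left_mono) auto
    also have "exp (b * 1) = exp 1 ^ b" using exp_of_nat_mult[of b "1::real"] by simp
    finally have "card (?O \<inter> ?A) / (card N choose k)
        \<le> (k / d) ^ b * (exp (- real k * (y / d)) * exp 1 ^ b)"
      using d by (simp add: mult_left_mono)
    also have "\<dots> = (exp 1 * k / d) ^ b * exp (- real k * (y / d))"
      by (simp add: power_mult_distrib power_divide mult_ac)
    finally show ?thesis unfolding prob b_def y_def .
  qed
qed

section \<open>Weighted certificates\<close>

text \<open>A certificate \<open>g\<close> encodes a rooted forest together with an orientation of its edges:
  \<open>g x = Some (True, y)\<close> says that \<open>x\<close> chose its parent \<open>y\<close>, and \<open>g x = Some (False, y)\<close> that the
  parent \<open>y\<close> chose \<open>x\<close>.\<close>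
definition arcs :: "'a set \<Rightarrow> ('a \<Rightarrow> (bool \<times> 'a) option) \<Rightarrow> 'a \<Rightarrow> 'a set" where
  "arcs V g v = {y. g v = Some (True, y)} \<union> {x \<in> V. g x = Some (False, v)}"

definition arc_weight :: "('a \<Rightarrow> real) \<Rightarrow> 'a \<Rightarrow> (bool \<times> 'a) option \<Rightarrow> real" where
  "arc_weight r x z = (case z of None \<Rightarrow> 1 | Some (b, y) \<Rightarrow> if b then r x else r y)"

text \<open>This makes the two parts of \<open>arcs\<close> disjoint, so that no forced choice is
  counted twice. Forests satisfy it, since two vertices cannot be parents of each other.\<close>

definition one_way :: "'a set \<Rightarrow> ('a \<Rightarrow> (bool \<times> 'a) option) \<Rightarrow> bool" where
  "one_way V g \<longleftrightarrow> (\<forall>x\<in>V. \<forall>y\<in>V. g x = Some (True, y) \<longrightarrow> g y \<noteq> Some (False, x))"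

text \<open>The left side is what independent choices at the vertices produce. The right side has
  one factor per value \<open>g x\<close>, so it can be summed over all \<open>g\<close> at once.
  Each arc is recounted at its child end.\<close>

lemma prod_arcs:
  fixes r :: "'a \<Rightarrow> real"
  assumes "finite V" "one_way V g" and gV: "\<And>x b y. x \<in> V \<Longrightarrow> g x = Some (b, y) \<Longrightarrow> y \<in> V"
  shows "(\<Prod>v\<in>V. r v ^ card (arcs V g v)) = (\<Prod>x\<in>V. arc_weight r x (g x))"
proof -
  define f where "f v = (\<Prod>x\<in>V. if g x = Some (False, v) then r v else 1)" for v
  have "r v ^ card (arcs V g v) = (if \<exists>y. g v = Some (True, y) then r v else 1) * f v"
    if "v \<in> V" for v
  proof -
    have "card (arcs V g v) = card {y. g v = Some (True, y)} + card {x \<in> V. g x = Some (False, v)}"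
      unfolding arcs_def
    proof (rule card_Un_disjoint)
      show "finite {y. g v = Some (True, y)}" by (cases "g v") auto
    qed (use assms that in \<open>auto simp: one_way_def\<close>)
    moreover have "r v ^ card {y. g v = Some (True, y)} = (if \<exists>y. g v = Some (True, y) then r v else 1)"
      by (auto simp: Collect_conv_if)
    moreover have "r v ^ card {x \<in> V. g x = Some (False, v)} = f v"
      using \<open>finite V\<close> by (simp add: f_def prod.If_cases Int_def)
    ultimately show ?thesis by (simp add: power_add)
  qed
  hence "(\<Prod>v\<in>V. r v ^ card (arcs V g v)) =
      (\<Prod>v\<in>V. if \<exists>y. g v = Some (True, y) then r v else 1) * (\<Prod>v\<in>V. f v)"
    by (simp add: prod.distrib)
  also have "(\<Prod>v\<in>V. f v) = (\<Prod>x\<in>V. \<Prod>v\<in>V. if g x = Some (False, v) then r v else 1)"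
    unfolding f_def by (rule prod.swap)
  also have "\<dots> = (\<Prod>x\<in>V. case g x of Some (False, y) \<Rightarrow> r y | _ \<Rightarrow> 1)"
  proof (intro prod.cong refl)
    fix x assume x: "x \<in> V"
    show "(\<Prod>v\<in>V. if g x = Some (False, v) then r v else 1) =
      (case g x of Some (False, y) \<Rightarrow> r y | _ \<Rightarrow> 1)"
    proof (cases "g x")
      case (Some z)
      obtain b y where z: "z = (b, y)" by force
      show ?thesis using Some gV[OF x, of b y] z \<open>finite V\<close>
        by (cases b) (auto simp: prod.delta)
    qed simp
  qed
  also have "(\<Prod>v\<in>V. if \<exists>y. g v = Some (True, y) then r v else 1) * \<dots> =
      (\<Prod>x\<in>V. arc_weight r x (g x))"
    unfolding prod.distrib[symmetric]
    by (intro prod.cong refl) (auto simp: arc_weight_def split: option.split prod.split bool.split)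
  finally show ?thesis .
qed

definition certificates :: "'a set \<Rightarrow> ('a \<Rightarrow> 'a \<Rightarrow> bool) \<Rightarrow> ('a \<Rightarrow> (bool \<times> 'a) option) set" where
  "certificates V E = (\<Pi>\<^sub>E x\<in>V. insert None (Some ` (UNIV \<times> nbrs E x)))"

text \<open>The arcs pointing towards \<open>x\<close> have total weight \<open>a * (\<Sum>y\<in>nbrs E x. 1 / card (nbrs E y))\<close>,
  which is unbounded for a single \<open>x\<close> but equals \<open>a\<close> on average; hence AM-GM.\<close>
lemma sum_certificates_weight:
  assumes G: "simple_graph V E" and deg: "\<And>v. v \<in> V \<Longrightarrow> nbrs E v \<noteq> {}" and "a > 0"
  shows "(\<Sum>g\<in>certificates V E. \<Prod>x\<in>V. arc_weight (\<lambda>v. a / card (nbrs E v)) x (g x))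
    \<le> (1 + 2 * a) ^ card V"
proof -
  let ?d = "\<lambda>v. real (card (nbrs E v))"
  let ?r = "\<lambda>v. a / ?d v"
  have fV: "finite V" and NV: "nbrs E v \<subseteq> V" for v
    using G by (auto simp: simple_graph_def nbrs_def)
  have fN: "finite (nbrs E v)" for v using NV fV finite_subset by metis
  have d: "?d v > 0" if "v \<in> V" for v using deg[OF that] fN by (simp add: card_gt_0_iff)
  define s where "s x = (\<Sum>y\<in>nbrs E x. 1 / ?d y)" for x
  \<comment> \<open>Every \<open>y\<close> hands out \<open>1 / ?d y\<close> to each of its
    \<open>?d y\<close> neighbours, so the total is \<open>card V\<close>.\<close>
  have "(\<Sum>x\<in>V. s x) = (\<Sum>x\<in>V. \<Sum>y\<in>V. if E x y then 1 / ?d y else 0)"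
  proof (intro sum.cong refl)
    fix x
    have "V \<inter> {y. E x y} = nbrs E x" using NV[of x] by (auto simp: nbrs_def)
    thus "s x = (\<Sum>y\<in>V. if E x y then 1 / ?d y else 0)"
      using fV by (simp add: s_def sum.If_cases)
  qed
  also have "\<dots> = (\<Sum>y\<in>V. \<Sum>x\<in>V. if E x y then 1 / ?d y else 0)" by (rule sum.swap)
  also have "\<dots> = (\<Sum>y\<in>V. 1)"
  proof (intro sum.cong refl)
    fix y assume y: "y \<in> V"
    have "{x \<in> V. E x y} = nbrs E y" using G by (auto simp: simple_graph_def nbrs_def)
    hence "(\<Sum>x\<in>V. if E x y then 1 / ?d y else 0) = ?d y * (1 / ?d y)"
      using fV by (simp add: sum.If_cases Int_def)
    thus "(\<Sum>x\<in>V. if E x y then 1 / ?d y else 0) = 1" using d[OF y] by simp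
  qed
  finally have s: "(\<Sum>x\<in>V. s x) = card V" by simp
  have opt: "(\<Sum>z\<in>insert None (Some ` (UNIV \<times> nbrs E x)). arc_weight ?r x z) = 1 + a + a * s x"
    if "x \<in> V" for x
  proof -
    have "(\<Sum>z\<in>insert None (Some ` (UNIV \<times> nbrs E x)). arc_weight ?r x z) =
       1 + (\<Sum>z\<in>UNIV \<times> nbrs E x. arc_weight ?r x (Some z))"
      using fN by (subst sum.insert) (auto simp: sum.reindex arc_weight_def)
    also have "(\<Sum>z\<in>UNIV \<times> nbrs E x. arc_weight ?r x (Some z)) =
        (\<Sum>b\<in>UNIV. \<Sum>y\<in>nbrs E x. arc_weight ?r x (Some (b, y)))"
      by (simp add: sum.cartesian_product case_prod_unfold)
    also have "\<dots> = ?d x * ?r x + (\<Sum>y\<in>nbrs E x. ?r y)"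
      by (simp add: UNIV_bool arc_weight_def)
    also have "(\<Sum>y\<in>nbrs E x. ?r y) = a * s x" by (simp add: s_def sum_distrib_left)
    finally show ?thesis using d[OF that] by simp
  qed
  have "(\<Sum>g\<in>certificates V E. \<Prod>x\<in>V. arc_weight ?r x (g x)) = (\<Prod>x\<in>V. 1 + a + a * s x)"
    unfolding certificates_def using fV fN opt by (subst prod_sum_PiE[symmetric]) auto
  \<comment> \<open>AM-GM in tangent-line form: the exponents
    \<open>a / (1 + 2 * a) * (s x - 1)\<close> sum to zero because \<open>s\<close> has average
    1.\<close>
  also have "\<dots> \<le> (\<Prod>x\<in>V. (1 + 2 * a) * exp (a / (1 + 2 * a) * (s x - 1)))"
  proof (intro prod_mono conjI)
    fix x
    have "s x \<ge> 0" unfolding s_def by (intro sum_nonneg) auto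
    thus "0 \<le> 1 + a + a * s x" using \<open>a > 0\<close> by simp
    have "1 + a + a * s x = (1 + 2 * a) * (1 + a / (1 + 2 * a) * (s x - 1))"
      using \<open>a > 0\<close> by (simp add: field_simps)
    also have "\<dots> \<le> (1 + 2 * a) * exp (a / (1 + 2 * a) * (s x - 1))"
      using \<open>a > 0\<close> by (intro mult_left_mono exp_ge_add_one_self) auto
    finally show "1 + a + a * s x \<le> (1 + 2 * a) * exp (a / (1 + 2 * a) * (s x - 1))" .
  qed
  also have "\<dots> = (1 + 2 * a) ^ card V * exp (\<Sum>x\<in>V. a / (1 + 2 * a) * (s x - 1))"
    using fV by (simp add: prod.distrib exp_sum)
  also have "(\<Sum>x\<in>V. a / (1 + 2 * a) * (s x - 1)) = 0"
    using s unfolding sum_distrib_left[symmetric] by (simp add: sum_subtractf)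
  finally show ?thesis by simp
qed

text \<open>For a fixed pair of \<open>g\<close> and \<open>lab\<close>, independence and
  \<open>prob_subset_contains_avoids\<close> bound the probability by the weight of \<open>g\<close>
  times \<open>exp (- \<delta> * k) ^ card V\<close>. In the union bound, the labellings contribute
  \<open>r ^ card V\<close> and the weights of all \<open>g\<close> at most
  \<open>(1 + 2 * (exp 1 * k)) ^ card V\<close>.\<close>

lemma prob_certificate_le:
  fixes Y :: "('a \<Rightarrow> (bool \<times> 'a) option) \<Rightarrow> nat \<Rightarrow> 'a \<Rightarrow> 'a set" and \<delta> :: real
  assumes G: "simple_graph V E" and "0 < k" and deg: "\<And>v. v \<in> V \<Longrightarrow> k \<le> card (nbrs E v)"
  shows "measure_pmf.prob (Pi_pmf V {} (choose_k E k))
    {c. \<exists>g\<in>certificates V E. \<exists>lab\<in>V \<rightarrow>\<^sub>E {..<r}. one_way V g \<and>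
       (\<forall>v\<in>V. arcs V g v \<subseteq> c v \<and> c v \<inter> Y g (lab v) v = {}) \<and>
       \<delta> * card V \<le> (\<Sum>v\<in>V. card (Y g (lab v) v \<inter> nbrs E v) / card (nbrs E v))}
    \<le> (r * (1 + 2 * (exp 1 * k)) * exp (- \<delta> * k)) ^ card V"
proof -
  let ?d = "\<lambda>v. real (card (nbrs E v))"
  let ?M = "Pi_pmf V {} (choose_k E k)"
  let ?L = "V \<rightarrow>\<^sub>E {..<r}"
  have fV: "finite V" and NV: "nbrs E v \<subseteq> V" for v
    using G by (auto simp: simple_graph_def nbrs_def)
  have fN: "finite (nbrs E v)" for v using NV fV finite_subset by metis
  define y where "y g lab v = card (Y g (lab v) v \<inter> nbrs E v) / ?d v" for g lab v
  define C where "C = {(g, lab) \<in> certificates V E \<times> ?L. one_way V g \<and> \<delta> * card V \<le> (\<Sum>v\<in>V. y g lab v)}"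
  define A where "A = (\<lambda>(g, lab). {c. \<forall>v\<in>V. arcs V g v \<subseteq> c v \<and> c v \<inter> Y g (lab v) v = {}})"
  define w where "w g = (\<Prod>x\<in>V. arc_weight (\<lambda>v. exp 1 * k / ?d v) x (g x))" for g
  have w0: "w g \<ge> 0" for g
    unfolding w_def by (intro prod_nonneg) (auto simp: arc_weight_def split: option.split)
  have fcert: "finite (certificates V E)" "finite ?L"
    unfolding certificates_def using fV fN by (auto intro!: finite_PiE)
  have fC: "finite C" using fcert by (auto simp: C_def intro: finite_subset[of _ "certificates V E \<times> ?L"])
  have A: "measure_pmf.prob ?M (A (g, lab)) \<le> w g * exp (- \<delta> * k) ^ card V"
    if C: "(g, lab) \<in> C" for g lab
  proof -
    have gV: "z \<in> V" if "x \<in> V" "g x = Some (b, z)" for x b z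
    proof -
      have "g x \<in> insert None (Some ` (UNIV \<times> nbrs E x))"
        using C PiE_mem[OF _ \<open>x \<in> V\<close>] unfolding C_def certificates_def by blast
      thus ?thesis using that NV by auto
    qed
    have "A (g, lab) = Pi V (\<lambda>v. {S. arcs V g v \<subseteq> S \<and> S \<inter> Y g (lab v) v = {}})"
      by (auto simp: A_def Pi_def)
    hence "measure_pmf.prob ?M (A (g, lab)) =
       (\<Prod>v\<in>V. measure_pmf.prob (choose_k E k v) {S. arcs V g v \<subseteq> S \<and> S \<inter> Y g (lab v) v = {}})"
      using measure_Pi_pmf_Pi[OF fV] by simp
    also have "\<dots> \<le> (\<Prod>v\<in>V. (exp 1 * k / ?d v) ^ card (arcs V g v) * exp (- k * y g lab v))"
    proof (intro prod_mono conjI)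
      fix v assume "v \<in> V"
      thus "measure_pmf.prob (choose_k E k v) {S. arcs V g v \<subseteq> S \<and> S \<inter> Y g (lab v) v = {}}
          \<le> (exp 1 * k / ?d v) ^ card (arcs V g v) * exp (- k * y g lab v)"
        using prob_subset_contains_avoids[OF fN \<open>0 < k\<close> deg] deg by (simp add: choose_k_def y_def)
    qed simp
    also have "\<dots> = w g * exp (\<Sum>v\<in>V. - k * y g lab v)"
      unfolding w_def prod.distrib using C gV fV
      by (subst prod_arcs) (auto simp: C_def exp_sum)
    also have "(\<Sum>v\<in>V. - k * y g lab v) \<le> - k * (\<delta> * card V)"
      using C by (auto simp: C_def sum_negf sum_distrib_left[symmetric] intro!: mult_left_mono)
    also have "- k * (\<delta> * card V) = card V * (- \<delta> * k)" by simp
    finally show ?thesis using w0[of g] by (simp only: exp_of_nat_mult) (simp add: mult_left_mono)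
  qed
  have "measure_pmf.prob ?M
    {c. \<exists>g\<in>certificates V E. \<exists>lab\<in>?L. one_way V g \<and>
       (\<forall>v\<in>V. arcs V g v \<subseteq> c v \<and> c v \<inter> Y g (lab v) v = {}) \<and>
       \<delta> * card V \<le> (\<Sum>v\<in>V. card (Y g (lab v) v \<inter> nbrs E v) / card (nbrs E v))}
      \<le> measure_pmf.prob ?M (\<Union>z\<in>C. A z)"
    by (intro measure_pmf.finite_measure_mono) (auto simp: C_def A_def y_def)
  also have "\<dots> \<le> (\<Sum>z\<in>C. measure_pmf.prob ?M (A z))"
    using fC by (intro measure_pmf.finite_measure_subadditive_finite) auto
  also have "\<dots> \<le> (\<Sum>z\<in>C. w (fst z) * exp (- \<delta> * k) ^ card V)"
    using A by (intro sum_mono) auto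
  \<comment> \<open>Dropping the constraints in \<open>C\<close> turns the index set into a
    product.\<close>
  also have "\<dots> \<le> (\<Sum>z\<in>certificates V E \<times> ?L. w (fst z) * exp (- \<delta> * k) ^ card V)"
    using fcert w0 by (intro sum_mono2) (auto simp: C_def)
  also have "\<dots> = (\<Sum>g\<in>certificates V E. w g) * (card ?L * exp (- \<delta> * k) ^ card V)"
    by (simp add: sum_distrib_right mult_ac sum.cartesian_product')
  also have "\<dots> \<le> (1 + 2 * (exp 1 * k)) ^ card V * (card ?L * exp (- \<delta> * k) ^ card V)"
  proof (intro mult_right_mono)
    have "nbrs E v \<noteq> {}" if "v \<in> V" for v using deg[OF that] \<open>0 < k\<close> by auto
    thus "(\<Sum>g\<in>certificates V E. w g) \<le> (1 + 2 * (exp 1 * k)) ^ card V"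
      unfolding w_def using G \<open>0 < k\<close> by (intro sum_certificates_weight) auto
  qed auto
  also have "card ?L = r ^ card V" using fV by (simp add: card_PiE)
  finally show ?thesis by (simp add: power_mult_distrib mult_ac)
qed

section \<open>Long cycles from forest chords\<close>

lemma has_cycle_len_geI:
  assumes "distinct xs" "3 \<le> length xs" "L \<le> real (length xs)"
    and "successively H xs" "H (last xs) (hd xs)"
  shows "has_cycle_len_ge H L"
  unfolding has_cycle_len_ge_def
proof (intro exI[of _ xs] conjI allI impI)
  fix i assume i: "i < length xs"
  have "xs \<noteq> []" using assms by auto
  show "H (xs ! i) (xs ! ((i + 1) mod length xs))"
  proof (cases "i + 1 = length xs")
    case True
    thus ?thesis using assms(5) \<open>xs \<noteq> []\<close> by (simp add: last_conv_nth hd_conv_nth flip: True)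
  next
    case False
    thus ?thesis using i assms(4) by (simp add: successively_conv_nth)
  qed
qed (use assms in auto)

context rooted_forest
begin

definition chain :: "'a \<Rightarrow> nat \<Rightarrow> 'a list" where
  "chain x n = map (\<lambda>i. the (ancestor p i x)) [0..<n]"

lemma length_chain [simp]: "length (chain x n) = n"
  by (simp add: chain_def)

lemma nth_chain: "ancestor p j x = Some y \<Longrightarrow> j < n \<Longrightarrow> chain x n ! j = y"
  by (simp add: chain_def)

lemma set_chain:
  assumes "ancestor p n x = Some y" "z \<in> set (chain x (Suc n))"
  obtains i where "i \<le> n" "ancestor p i x = Some z" "ancestor p (n - i) z = Some y"
proof -
  obtain i where i: "i \<le> n" "z = the (ancestor p i x)"
    using assms by (auto simp: chain_def less_Suc_eq_le simp del: upt_Suc)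
  then obtain z' where "ancestor p i x = Some z'" "ancestor p (n - i) z' = Some y"
    using ancestor_le_Some[OF assms(1), of i] by blast
  thus ?thesis using i that by auto
qed

lemma distinct_chain:
  assumes "ancestor p n x = Some y"
  shows "distinct (chain x (Suc n))"
  unfolding distinct_conv_nth
proof (intro allI impI)
  fix i j assume ij: "i < length (chain x (Suc n))" "j < length (chain x (Suc n))" "i \<noteq> j"
  have "i \<le> n" "j \<le> n" using ij by auto
  obtain a where a: "ancestor p i x = Some a"
    using ancestor_le_Some[OF assms \<open>i \<le> n\<close>] by blast
  obtain b where b: "ancestor p j x = Some b"
    using ancestor_le_Some[OF assms \<open>j \<le> n\<close>] by blast
  have "a \<noteq> b" using ancestor_depth[OF a] ancestor_depth[OF b] ij by auto
  thus "chain x (Suc n) ! i \<noteq> chain x (Suc n) ! j" using nth_chain[OF a] nth_chain[OF b] ij by simp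
qed

lemma successively_chain:
  assumes "ancestor p n x = Some y" and H: "\<And>x y. p x = Some y \<Longrightarrow> H x y"
  shows "successively H (chain x (Suc n))"
  unfolding successively_conv_nth
proof (intro allI impI)
  fix i assume "Suc i < length (chain x (Suc n))"
  hence i: "Suc i \<le> n" by simp
  obtain b where b: "ancestor p (Suc i) x = Some b"
    using ancestor_le_Some[OF assms(1) i] by blast
  then obtain a where a: "ancestor p i x = Some a" "p a = Some b" by (auto simp: bind_eq_Some_conv)
  show "H (chain x (Suc n) ! i) (chain x (Suc n) ! Suc i)"
    using nth_chain[OF a(1)] nth_chain[OF b] i H[OF a(2)] by simp
qed

lemma hd_chain [simp]: "hd (chain x (Suc n)) = x"
  by (simp add: chain_def hd_map del: upt_Suc)

lemma last_chain: "ancestor p n x = Some y \<Longrightarrow> last (chain x (Suc n)) = y"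
  by (simp add: chain_def)

lemma chain_not_Nil [simp]: "chain x (Suc n) \<noteq> []"
  by (simp add: chain_def)

lemma cycle_one_chord:
  assumes H: "\<And>x y. p x = Some y \<Longrightarrow> H x y"
    and "ancestor p j v = Some w" "2 \<le> j" "H w v" "L \<le> real (Suc j)"
  shows "has_cycle_len_ge H L"
proof (rule has_cycle_len_geI)
  show "distinct (chain v (Suc j))" using assms(2) by (rule distinct_chain)
  show "successively H (chain v (Suc j))" using assms(2) H by (rule successively_chain)
  show "H (last (chain v (Suc j))) (hd (chain v (Suc j)))"
    using assms by (simp add: last_chain)
qed (use assms in auto)

text \<open>The cycle climbs from \<open>u\<close> to \<open>a\<close>, jumps to \<open>v\<close>,
  descends to \<open>b\<close> and jumps back to \<open>u\<close>. The two paths are disjoint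
  because one stays at depth at most that of \<open>u\<close> and the other at depth at least that
  of \<open>v\<close>.\<close>

lemma cycle_two_chords:
  assumes H: "\<And>x y. p x = Some y \<Longrightarrow> H x y" and sym: "\<And>x y. H x y \<Longrightarrow> H y x"
    and u: "p v = Some u" and a: "ancestor p i u = Some a" "H v a"
    and b: "ancestor p j b = Some v" "H u b"
    and len: "3 \<le> Suc i + Suc j" "L \<le> real (Suc i + Suc j)"
  shows "has_cycle_len_ge H L"
proof (rule has_cycle_len_geI)
  let ?xs = "chain u (Suc i) @ rev (chain b (Suc j))"
  have "set (chain u (Suc i)) \<inter> set (chain b (Suc j)) = {}"
  proof (intro equals0I)
    fix z assume z: "z \<in> set (chain u (Suc i)) \<inter> set (chain b (Suc j))"
    obtain i' where "ancestor p i' u = Some z" using z set_chain[OF a(1)] by blast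
    moreover obtain j' where "ancestor p j' z = Some v" using z set_chain[OF b(1)] by blast
    ultimately show False using ancestor_depth parent[OF u] by fastforce
  qed
  thus "distinct ?xs" using distinct_chain[OF a(1)] distinct_chain[OF b(1)] by simp
  have "successively H (chain b (Suc j))" using b(1) H by (rule successively_chain)
  moreover have "(\<lambda>x y. H y x) = H" using sym by blast
  ultimately have "successively H (rev (chain b (Suc j)))" by (simp only: successively_rev)
  thus "successively H ?xs"
    using successively_chain[where H = H, OF a(1)] H last_chain[OF a(1)] last_chain[OF b(1)] a(2) sym
    by (simp add: successively_append_iff hd_rev)
  show "H (last ?xs) (hd ?xs)" using b(2) sym by (simp add: last_rev)
qed (use len in auto)

end

section \<open>Chord targets, lucky and unlucky vertices\<close>

definition near_anc_nbrs :: "('a \<Rightarrow> 'a \<Rightarrow> bool) \<Rightarrow> nat \<Rightarrow> ('a \<Rightarrow> 'a option) \<Rightarrow> 'a \<Rightarrow> 'a set" where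
  "near_anc_nbrs E l p v = {w \<in> nbrs E v. \<exists>j. 1 \<le> j \<and> j < l \<and> ancestor p j v = Some w}"

definition near_desc_nbrs :: "('a \<Rightarrow> 'a \<Rightarrow> bool) \<Rightarrow> nat \<Rightarrow> ('a \<Rightarrow> 'a option) \<Rightarrow> 'a \<Rightarrow> 'a set" where
  "near_desc_nbrs E l p v = {w \<in> nbrs E v. \<exists>j. 1 \<le> j \<and> j < l \<and> ancestor p j w = Some v}"

text \<open>A typical vertex chooses a neighbour in each of these four sets that is not too small. As the
  edges of the random graph join comparable vertices, the set for \<open>i = 0\<close> must then be small; a
  choice in the set for \<open>i = 1\<close> closes a long cycle; and choices in the other two are chords that
  span about as many vertices as there are near ancestors (descendants) among the neighbours.\<close>
definition targets ::
    "('a \<Rightarrow> 'a \<Rightarrow> bool) \<Rightarrow> nat \<Rightarrow> real \<Rightarrow> ('a \<Rightarrow> 'a option) \<Rightarrow> nat \<Rightarrow> 'a \<Rightarrow> 'a set" where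
  "targets E l x p i v =
    (if i = 0 then {w \<in> nbrs E v. \<forall>j. ancestor p j v \<noteq> Some w \<and> ancestor p j w \<noteq> Some v}
     else if i = 1 then {w \<in> nbrs E v. \<exists>j\<ge>l. ancestor p j v = Some w \<or> ancestor p j w = Some v}
     else if i = 2 then {w \<in> nbrs E v. \<exists>j. 1 \<le> j \<and> j < l \<and> ancestor p j v = Some w \<and>
       real (card (near_anc_nbrs E l p v)) - x \<le> real j}
     else {w \<in> nbrs E v. \<exists>j. 1 \<le> j \<and> j < l \<and> ancestor p j w = Some v \<and>
       real (card (near_desc_nbrs E l p v)) - 2 * x \<le> real j})"

lemma targets_subset: "targets E l x p i v \<subseteq> nbrs E v"
  by (auto simp: targets_def)

text \<open>Elements of \<open>certificates V E\<close> are \<open>undefined\<close> outside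
  \<open>V\<close>, hence the explicit \<open>None\<close> there.\<close>

definition parent_of :: "'a set \<Rightarrow> ('a \<Rightarrow> (bool \<times> 'a) option) \<Rightarrow> 'a \<Rightarrow> 'a option" where
  "parent_of V g x = (if x \<in> V then map_option snd (g x) else None)"

definition out_graph :: "'a set \<Rightarrow> ('a \<Rightarrow> 'a set) \<Rightarrow> 'a \<Rightarrow> 'a \<Rightarrow> bool" where
  "out_graph V c x y \<longleftrightarrow> x \<in> V \<and> y \<in> V \<and> (y \<in> c x \<or> x \<in> c y)"

text \<open>The label \<open>r\<close> marks the vertices at which no set is required to be missed.\<close>
definition bad_choices ::
    "'a set \<Rightarrow> ('a \<Rightarrow> 'a \<Rightarrow> bool) \<Rightarrow> nat \<Rightarrow> (('a \<Rightarrow> 'a option) \<Rightarrow> nat \<Rightarrow> 'a \<Rightarrow> 'a set) \<Rightarrow> real \<Rightarrow> ('a \<Rightarrow> 'a set) set"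
  where "bad_choices V E r T \<delta> = {c. \<exists>g\<in>certificates V E. \<exists>lab\<in>V \<rightarrow>\<^sub>E {..<Suc r}. one_way V g \<and>
    (\<forall>v\<in>V. arcs V g v \<subseteq> c v \<and> c v \<inter> (if lab v < r then T (parent_of V g) (lab v) v else {}) = {}) \<and>
    (\<delta>::real) * real (card V) \<le> (\<Sum>v\<in>V. card ((if lab v < r then T (parent_of V g) (lab v) v else {}) \<inter> nbrs E v)
       / card (nbrs E v))}"

text \<open>The search forest of \<open>out_graph V c\<close>, oriented by who chose whom, is a
  certificate. Each unlucky vertex is labelled by a large set that it misses and so adds at least
  \<open>\<theta>\<close> to the sum in \<open>bad_choices\<close>; hence
  \<open>\<kappa> * card V\<close> unlucky vertices would make \<open>c\<close> bad.\<close>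

lemma ex_forest_few_unlucky:
  fixes \<theta> \<kappa> :: real
  assumes G: "simple_graph V E" and deg: "\<And>v. v \<in> V \<Longrightarrow> nbrs E v \<noteq> {}"
    and c: "\<And>v. v \<in> V \<Longrightarrow> c v \<subseteq> nbrs E v" and T: "\<And>p i v. T p i v \<subseteq> nbrs E v"
    and "\<theta> > 0" and good: "c \<notin> bad_choices V E r T (\<kappa> * \<theta>)"
  shows "\<exists>p depth. rooted_forest V p depth \<and> (\<forall>x y. p x = Some y \<longrightarrow> out_graph V c x y) \<and>
    (\<forall>x y. out_graph V c x y \<longrightarrow> (\<exists>j. ancestor p j x = Some y \<or> ancestor p j y = Some x)) \<and>
    card {v \<in> V. \<exists>i<r. \<theta> * card (nbrs E v) \<le> card (T p i v) \<and> c v \<inter> T p i v = {}} < \<kappa> * card V"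
proof -
  have fV: "finite V" and NV: "nbrs E v \<subseteq> V" and irr: "v \<notin> nbrs E v" for v
    using G by (auto simp: simple_graph_def nbrs_def)
  have fN: "finite (nbrs E v)" for v using NV fV finite_subset by metis
  have Hsym: "out_graph V c x y \<Longrightarrow> out_graph V c y x" for x y by (auto simp: out_graph_def)
  have Hirr: "\<not> out_graph V c x x" for x using c irr by (auto simp: out_graph_def)
  have HE: "y \<in> nbrs E x" if "out_graph V c x y" for x y
    using that c G by (fastforce simp: out_graph_def nbrs_def simple_graph_def)
  from ex_normal_forest[where H = "out_graph V c", OF fV Hsym Hirr]
  obtain p depth where F: "rooted_forest V p depth"
    and pH: "\<And>x y. p x = Some y \<Longrightarrow> out_graph V c x y"
    and cmp: "\<forall>x\<in>V. \<forall>y\<in>V. out_graph V c x y \<longrightarrow> (\<exists>j. ancestor p j x = Some y \<or> ancestor p j y = Some x)"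
    by blast
  interpret rooted_forest V p depth by fact
  define W where "W = {v \<in> V. \<exists>i<r. \<theta> * card (nbrs E v) \<le> card (T p i v) \<and> c v \<inter> T p i v = {}}"
  \<comment> \<open>If \<open>x\<close> did not choose its parent, the edge between them comes from
    the parent's choice, so the value \<open>False\<close> is justified.\<close>
  define g where "g = (\<lambda>x\<in>V. map_option (\<lambda>y. (y \<in> c x, y)) (p x))"
  define lab where "lab = (\<lambda>v\<in>V. if v \<in> W
     then SOME i. i < r \<and> \<theta> * card (nbrs E v) \<le> card (T p i v) \<and> c v \<inter> T p i v = {} else r)"
  have labW: "lab v < r \<and> \<theta> * card (nbrs E v) \<le> card (T p (lab v) v) \<and> c v \<inter> T p (lab v) v = {}"
    if "v \<in> W" for v
  proof -
    have "\<exists>i. i < r \<and> \<theta> * card (nbrs E v) \<le> card (T p i v) \<and> c v \<inter> T p i v = {}"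
      using that by (auto simp: W_def)
    from someI_ex[OF this] show ?thesis using that by (simp add: lab_def W_def)
  qed
  have labr: "lab v = r" if "v \<in> V - W" for v using that by (simp add: lab_def)
  have par: "parent_of V g = p"
  proof
    fix x show "parent_of V g x = p x"
      using parent by (cases "p x") (auto simp: parent_of_def g_def)
  qed
  let ?Y = "\<lambda>v. if lab v < r then T p (lab v) v else {}"
  have gI: "g \<in> certificates V E"
    unfolding certificates_def
  proof (rule PiE_I)
    fix x assume "x \<in> V"
    thus "g x \<in> insert None (Some ` (UNIV \<times> nbrs E x))"
      using pH HE by (cases "p x") (auto simp: g_def)
  qed (simp add: g_def)
  have labI: "lab \<in> V \<rightarrow>\<^sub>E {..<Suc r}"
  proof (rule PiE_I)
    fix x assume "x \<in> V"
    thus "lab x \<in> {..<Suc r}" using labW labr by (cases "x \<in> W") fastforce+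
  qed (simp add: lab_def)
  have ow: "one_way V g"
    unfolding one_way_def
  proof (intro ballI impI notI)
    fix x y assume "x \<in> V" "y \<in> V" "g x = Some (True, y)" "g y = Some (False, x)"
    hence "p x = Some y" "p y = Some x" unfolding par[symmetric] by (auto simp: parent_of_def)
    thus False using parent[of x y] parent[of y x] by simp
  qed
  have av: "arcs V g v \<subseteq> c v \<and> c v \<inter> ?Y v = {}" if "v \<in> V" for v
  proof
    show "arcs V g v \<subseteq> c v"
      using that pH by (auto simp: arcs_def g_def out_graph_def)
    show "c v \<inter> ?Y v = {}" using labW labr that by (cases "v \<in> W") auto
  qed
  have sumW: "\<theta> * card W \<le> (\<Sum>v\<in>V. card (?Y v \<inter> nbrs E v) / card (nbrs E v))"
  proof -
    have "\<theta> * card W = (\<Sum>v\<in>W. \<theta>)" by simp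
    also have "\<dots> \<le> (\<Sum>v\<in>W. card (?Y v \<inter> nbrs E v) / card (nbrs E v))"
    proof (intro sum_mono)
      fix v assume v: "v \<in> W"
      hence "card (nbrs E v) > 0" using deg fN by (auto simp: W_def card_gt_0_iff)
      moreover have "?Y v \<inter> nbrs E v = T p (lab v) v" using labW[OF v] T by auto
      ultimately show "\<theta> \<le> card (?Y v \<inter> nbrs E v) / card (nbrs E v)"
        using labW[OF v] by (simp add: field_simps)
    qed
    also have "\<dots> \<le> (\<Sum>v\<in>V. card (?Y v \<inter> nbrs E v) / card (nbrs E v))"
      using fV by (intro sum_mono2) (auto simp: W_def)
    finally show ?thesis .
  qed
  have "\<not> \<kappa> * \<theta> * card V \<le> \<theta> * card W"
  proof
    assume "\<kappa> * \<theta> * card V \<le> \<theta> * card W"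
    hence le: "\<kappa> * \<theta> * card V \<le> (\<Sum>v\<in>V. card (?Y v \<inter> nbrs E v) / card (nbrs E v))"
      using sumW by linarith
    have "c \<in> bad_choices V E r T (\<kappa> * \<theta>)"
      unfolding bad_choices_def mem_Collect_eq
    proof (intro bexI[OF _ gI] bexI[OF _ labI] conjI ballI ow)
      fix v assume v: "v \<in> V"
      show "arcs V g v \<subseteq> c v" using av[OF v] by blast
      show "c v \<inter> (if lab v < r then T (parent_of V g) (lab v) v else {}) = {}"
        using av[OF v] unfolding par by blast
    qed (use le in \<open>simp only: par\<close>)
    thus False using good by contradiction
  qed
  hence "card W < \<kappa> * card V"
    using \<open>\<theta> > 0\<close> by (auto simp: not_le mult.commute mult.left_commute)
  thus ?thesis using F pH cmp unfolding W_def out_graph_def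
    by (intro exI[of _ p] exI[of _ depth]) (auto simp: out_graph_def)
qed

section \<open>Long cycles in forests with few unlucky vertices\<close>

context rooted_forest
begin

text \<open>\<open>W\<close> collects the unlucky vertices. There are at most
  \<open>(1 + 4 / \<epsilon>) * card W\<close> low vertices, and at most \<open>1 / \<eta>\<close>
  times as many heavy ones as low ones; a chain of \<open>t + 1\<close> vertices has to avoid all
  three sets. This explains the factor in front of \<open>card W\<close>.\<close>

lemma cycle_of_lucky_forest:
  fixes \<epsilon> \<eta> \<theta> :: real and m t :: nat
  assumes G: "simple_graph V E" and "V \<noteq> {}" and deg: "\<And>v. v \<in> V \<Longrightarrow> m \<le> card (nbrs E v)"
    and H: "\<And>x y. p x = Some y \<Longrightarrow> H x y" and sym: "\<And>x y. H x y \<Longrightarrow> H y x"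
    and cH: "\<And>v w. v \<in> V \<Longrightarrow> w \<in> c v \<Longrightarrow> H v w"
    and eps: "0 < \<epsilon>" "\<epsilon> \<le> 1 / 2" and eta: "\<eta> = \<epsilon> / 10" and theta: "\<theta> = \<eta> / 8"
    and t: "1 \<le> t * \<eta>" and m: "2 \<le> \<eta> * m" "2 * t \<le> m"
  defines "l \<equiv> nat \<lceil>(1 - \<epsilon>) * m\<rceil>"
  defines "T \<equiv> targets E l (\<eta> * m) p"
  assumes T0: "\<And>v. v \<in> V \<Longrightarrow> c v \<inter> T 0 v = {}"
  defines "W \<equiv> {v \<in> V. \<exists>i<4. \<theta> * card (nbrs E v) \<le> card (T i v) \<and> c v \<inter> T i v = {}}"
  assumes W: "real (t + 1) * (1 + (1 + 4 / \<epsilon>) * (1 + 1 / \<eta>)) * card W < card V"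
  shows "has_cycle_len_ge H ((1 - \<epsilon>) * m)"
proof (rule ccontr)
  assume no_cycle: "\<not> ?thesis"
  have NV: "nbrs E v \<subseteq> V" and irr: "v \<notin> nbrs E v" for v
    using G by (auto simp: simple_graph_def nbrs_def)
  have fN: "finite (nbrs E v)" for v using NV finite_V finite_subset by metis
  define d where "d v = real (card (nbrs E v))" for v
  have dm: "d v \<ge> m" if "v \<in> V" for v using deg[OF that] by (simp add: d_def)
  define a where "a v = real (card (near_anc_nbrs E l p v))" for v
  define b where "b v = real (card (near_desc_nbrs E l p v))" for v
  define M where "M = real m"
  \<comment> \<open>\<open>e\<close> is the unit of error: \<open>l\<close> equals
    \<open>M - 10 * e\<close> up to rounding, and the losses below are counted in multiples of
    \<open>e\<close>.\<close>
  define e where "e = \<eta> * M"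
  have eM: "\<epsilon> * M = 10 * e" using eta by (simp add: e_def)
  have th: "8 * (\<theta> * M) = e" "0 < \<theta>" "\<theta> \<le> 1 / 160" using theta eta eps by (simp_all add: e_def)
  have e2: "2 \<le> e" using m by (simp add: e_def M_def)
  have M20: "20 * e \<le> M" using eps eM mult_right_mono[OF eps(2), of M] by (simp add: M_def)
  have eta0: "0 < \<eta>" using eps eta by simp
  have l: "M - 10 * e \<le> l" "l < M - 10 * e + 1" "l \<le> M"
  proof -
    have x: "(1 - \<epsilon>) * m = M - 10 * e" using eM by (simp add: M_def algebra_simps)
    have "0 \<le> M - 10 * e" using M20 e2 by simp
    hence lr: "real l = of_int \<lceil>M - 10 * e\<rceil>" unfolding l_def x by simp
    show l12: "M - 10 * e \<le> l" "l < M - 10 * e + 1" unfolding lr by linarith+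
    thus "l \<le> M" using e2 by linarith
  qed
  have l1: "1 \<le> l" "2 \<le> l" using l(1) M20 e2 by linarith+
  have el: "(1 + \<eta>) * l \<le> l + e"
    using l(3) eta0 by (simp add: e_def algebra_simps)
  have tl: "t \<le> l"
    using m(2) l(1) M20 unfolding M_def by linarith
  text \<open>Since no chord may span \<open>l\<close> edges of the forest, almost all neighbours of a lucky vertex
    are near ancestors or near descendants.\<close>
  have far: False if "v \<in> V" "w \<in> c v" "w \<in> T 1 v" for v w
  proof -
    have "\<exists>j\<ge>l. ancestor p j v = Some w \<or> ancestor p j w = Some v"
      using that(3) by (simp add: T_def targets_def)
    then obtain j where j: "l \<le> j" "ancestor p j v = Some w \<or> ancestor p j w = Some v" by blast
    have "(1 - \<epsilon>) * m \<le> real (Suc j)" using j(1) by (simp add: l_def)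
    moreover have "2 \<le> j" using j l1 by simp
    ultimately have "has_cycle_len_ge H ((1 - \<epsilon>) * m)"
      using j(2) cycle_one_chord[where H = H and j = j, OF H] cH[OF that(1,2)] sym by blast
    thus False using no_cycle by simp
  qed
  have hit: "c v \<inter> T i v \<noteq> {}" if "v \<in> V - W" "i < 4" "\<theta> * d v \<le> card (T i v)" for v i
    using that by (auto simp: W_def d_def)
  have ab: "(1 - 2 * \<theta>) * d v \<le> a v + b v" if v: "v \<in> V - W" for v
  proof -
    have "nbrs E v \<subseteq> (T 0 v \<union> T 1 v) \<union> (near_anc_nbrs E l p v \<union> near_desc_nbrs E l p v)"
    proof
      fix w assume w: "w \<in> nbrs E v"
      hence "w \<noteq> v" using irr by blast
      show "w \<in> (T 0 v \<union> T 1 v) \<union> (near_anc_nbrs E l p v \<union> near_desc_nbrs E l p v)"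
      proof (cases "w \<in> T 0 v")
        case False
        then obtain j where j: "ancestor p j v = Some w \<or> ancestor p j w = Some v"
          using w by (auto simp: T_def targets_def)
        have "j \<noteq> 0" using j \<open>w \<noteq> v\<close> by (cases j) auto
        hence "1 \<le> j" by simp
        thus ?thesis using j w
          by (cases "j < l") (auto simp: T_def targets_def near_anc_nbrs_def near_desc_nbrs_def)
      qed simp
    qed
    moreover have "finite (T i v)" for i
      using targets_subset fN finite_subset unfolding T_def by metis
    moreover have "finite (near_anc_nbrs E l p v)" "finite (near_desc_nbrs E l p v)"
      using fN by (auto simp: near_anc_nbrs_def near_desc_nbrs_def)
    ultimately have "card (nbrs E v) \<le> card ((T 0 v \<union> T 1 v) \<union> (near_anc_nbrs E l p v \<union> near_desc_nbrs E l p v))"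
      by (intro card_mono) auto
    also have "\<dots> \<le> (card (T 0 v) + card (T 1 v)) + (card (near_anc_nbrs E l p v) + card (near_desc_nbrs E l p v))"
      by (intro order_trans[OF card_Un_le] add_mono card_Un_le)
    finally have "d v \<le> card (T 0 v) + card (T 1 v) + a v + b v"
      unfolding d_def a_def b_def by linarith
    moreover have "card (T 0 v) < \<theta> * d v"
      using hit[OF v, of 0] T0 v by force
    moreover have "card (T 1 v) < \<theta> * d v"
      using hit[OF v, of 1] far[of v] v by force
    ultimately show ?thesis by (simp add: algebra_simps)
  qed
  have ab': "M - e / 4 \<le> a v + b v" if v: "v \<in> V - W" for v
  proof -
    have "(1 - 2 * \<theta>) * M \<le> (1 - 2 * \<theta>) * d v"
      using dm[of v] v th by (intro mult_left_mono) (auto simp: M_def)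
    thus ?thesis using ab[OF v] th by (simp add: algebra_simps)
  qed
  have card_anc: "card (\<Union>j\<in>J. set_option (ancestor p j v)) \<le> card J" if "finite J" for J v
  proof -
    have "card (\<Union>j\<in>J. set_option (ancestor p j v)) \<le> (\<Sum>j\<in>J. card (set_option (ancestor p j v)))"
      using that by (rule card_UN_le)
    also have "\<dots> \<le> (\<Sum>j\<in>J. 1)"
    proof (intro sum_mono)
      fix j show "card (set_option (ancestor p j v)) \<le> 1" by (cases "ancestor p j v") auto
    qed
    finally show ?thesis by simp
  qed
  have a_le: "a v \<le> M - 10 * e" for v
  proof -
    have "near_anc_nbrs E l p v \<subseteq> (\<Union>j\<in>{1..<l}. set_option (ancestor p j v))"
      by (fastforce simp: near_anc_nbrs_def)
    hence "card (near_anc_nbrs E l p v) \<le> card (\<Union>j\<in>{1..<l}. set_option (ancestor p j v))"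
      by (intro card_mono) auto
    also have "\<dots> \<le> l - 1" using card_anc[of "{1..<l}"] by simp
    finally have "a v \<le> real l - 1" using l1 by (simp add: a_def of_nat_diff)
    thus ?thesis using l by linarith
  qed
  have b_ge: "9 * e \<le> b v" if "v \<in> V - W" for v
    using ab'[OF that] a_le[of v] e2 by linarith
  \<comment> \<open>\<open>5 * e\<close> lies below the bound \<open>9 * e \<le> b v\<close>, so
    lucky vertices are not poor, yet it is large enough for
    \<open>l / s \<le> 4 / \<epsilon>\<close>.\<close>
  define s where "s = nat \<lfloor>5 * e\<rfloor>"
  have s: "5 * e - 1 < s" "s \<le> 5 * e" unfolding s_def using e2 by linarith+
  have "poor s \<subseteq> W"
  proof
    fix v assume v: "v \<in> poor s"
    show "v \<in> W"
    proof (rule ccontr)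
      assume "v \<notin> W"
      hence vW: "v \<in> V - W" using v by (auto simp: poor_def)
      have "near_desc_nbrs E l p v \<subseteq> all_desc v"
        by (auto simp: near_desc_nbrs_def all_desc_def desc_def)
      moreover have "finite (all_desc v)" using vW all_desc_subset finite_V finite_subset by (metis DiffD1)
      ultimately have "card (near_desc_nbrs E l p v) \<le> card (all_desc v)" by (intro card_mono)
      also have "\<dots> \<le> s" using v by (simp add: poor_def)
      finally have "b v \<le> s" by (simp add: b_def)
      thus False using b_ge[OF vW] s e2 by linarith
    qed
  qed
  have WV: "W \<subseteq> V" by (auto simp: W_def)
  have fW: "finite W" using WV finite_V finite_subset by metis
  have pW: "card (poor s) \<le> card W" using \<open>poor s \<subseteq> W\<close> fW card_mono by metis
  have s0: "real s > 0" using s e2 by linarith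
  have low: "real (card (low l)) \<le> (1 + 4 / \<epsilon>) * card W"
  proof -
    have "real (s * card (low l)) \<le> real (s * card (poor s) + l * card (poor s))"
      by (rule of_nat_mono[OF card_low])
    hence "s * real (card (low l)) \<le> (real s + real l) * real (card (poor s))"
      by (simp add: algebra_simps)
    also have "\<dots> \<le> (real s + real l) * card W" using pW by (intro mult_left_mono) auto
    also have "real s + real l \<le> real s * (1 + 4 / \<epsilon>)"
    proof -
      have "\<epsilon> * real l \<le> \<epsilon> * M" using l(3) eps by simp
      also have "\<dots> \<le> 4 * real s" using eM s e2 by linarith
      finally have "real l \<le> 4 * real s / \<epsilon>" using eps by (simp add: field_simps)
      thus ?thesis by (simp add: algebra_simps)
    qed
    finally have "s * real (card (low l)) \<le> s * ((1 + 4 / \<epsilon>) * card W)"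
      by (simp add: mult.assoc mult_right_mono)
    thus ?thesis using s0 by (simp only: mult_le_cancel_left_pos)
  qed
  define B where "B = W \<union> low l \<union> heavy l \<eta>"
  have BV: "B \<subseteq> V" by (auto simp: B_def W_def low_def heavy_def)
  have "real (card B) \<le> real (card W) + real (card (low l)) + real (card (heavy l \<eta>))"
    unfolding B_def using card_Un_le[of "W \<union> low l" "heavy l \<eta>"] card_Un_le[of W "low l"] by linarith
  also have "real (card (heavy l \<eta>)) \<le> card (low l) / \<eta>"
    using card_heavy[of l \<eta>] l1 eta0 by (simp add: field_simps)
  also have "real (card W) + real (card (low l)) + card (low l) / \<eta>
      = card W + card (low l) * (1 + 1 / \<eta>)"
    by (simp add: algebra_simps)
  also have "\<dots> \<le> card W + ((1 + 4 / \<epsilon>) * card W) * (1 + 1 / \<eta>)"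
    using low eta0 by (intro add_left_mono mult_right_mono) auto
  finally have B: "real (card B) \<le> (1 + (1 + 4 / \<epsilon>) * (1 + 1 / \<eta>)) * card W"
    by (simp add: algebra_simps)
  have "real (t + 1) * real (card B) \<le> real (t + 1) * ((1 + (1 + 4 / \<epsilon>) * (1 + 1 / \<eta>)) * card W)"
    by (intro mult_left_mono[OF B]) simp
  also have "\<dots> < card V" using W by (simp add: mult.assoc)
  finally have "real (Suc t * card B) < real (card V)" by (simp add: algebra_simps)
  hence "Suc t * card B < card V" by (simp only: of_nat_less_iff)
  moreover have "low l \<subseteq> B" by (auto simp: B_def)
  ultimately obtain v0 where v0: "\<And>j. j \<le> t \<Longrightarrow> \<exists>w\<in>V - B. ancestor p j v0 = Some w"
    using ex_chain_avoiding[OF _ BV tl] by metis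
  define f where "f j = the (ancestor p j v0)" for j
  have f: "ancestor p j v0 = Some (f j)" "f j \<in> V - B" if "j \<le> t" for j
    using v0[OF that] by (auto simp: f_def)
  \<comment> \<open>Otherwise \<open>a\<close> would gain more than \<open>e\<close> at each of
    \<open>t\<close> steps up the chain and reach \<open>t * e \<ge> M\<close>, beyond its upper
    bound.\<close>
  have "\<exists>i<t. a (f (Suc i)) \<le> a (f i) + e"
  proof (rule ccontr)
    assume "\<not> ?thesis"
    hence *: "a (f i) + e < a (f (Suc i))" if "i < t" for i using that by (auto simp: not_le)
    have "j * e \<le> a (f j)" if "j \<le> t" for j
      using that
    proof (induction j)
      case (Suc j)
      thus ?case using *[of j] by (simp add: algebra_simps)
    qed (simp add: a_def)
    hence "t * e \<le> a (f t)" by simp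
    moreover have "M \<le> t * e"
      using t mult_right_mono[OF t, of M] by (simp add: e_def M_def mult.assoc)
    ultimately show False using a_le[of "f t"] e2 by linarith
  qed
  then obtain i where i: "i < t" "a (f (Suc i)) \<le> a (f i) + e" by blast
  define v where "v = f i"
  define u where "u = f (Suc i)"
  have v: "v \<in> V - B" and u: "u \<in> V - B" and pv: "p v = Some u"
    using f[of i] f[of "Suc i"] i by (auto simp: v_def u_def)
  have vW: "v \<in> V - W" and uW: "u \<in> V - W" and vl: "v \<in> V - low l" and ul: "u \<in> V - low l"
    using v u by (auto simp: B_def)
  have near_le: "card (near_desc l w) \<le> l + e" if "w \<in> V - B" for w
    using that el by (auto simp: B_def heavy_def not_less)
  have b_le: "b w \<le> l + e" if w: "w \<in> V - B" for w
  proof -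
    have "near_desc_nbrs E l p w \<subseteq> near_desc l w"
      by (auto simp: near_desc_nbrs_def near_desc_def desc_def)
    hence "card (near_desc_nbrs E l p w) \<le> card (near_desc l w)"
      using w finite_near_desc by (intro card_mono) auto
    thus ?thesis using near_le[OF w] by (simp add: b_def)
  qed
  \<comment> \<open>Outside \<open>B\<close> almost all neighbours are counted by
    \<open>a w + b w \<le> 3 * M\<close>. So degrees there are of order \<open>M\<close>, and
    hitting thresholds relative to the degree become absolute ones.\<close>
  have d_le: "\<theta> * d w \<le> e / 2" if w: "w \<in> V - B" for w
  proof -
    have "w \<in> V - W" using w by (auto simp: B_def)
    have "(3 / 4) * d w \<le> (1 - 2 * \<theta>) * d w"
      using th by (intro mult_right_mono) (auto simp: d_def)
    also have "\<dots> \<le> a w + b w" by (rule ab) fact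
    also have "\<dots> \<le> 3 * M" using a_le[of w] b_le[OF w] l e2 M20 by linarith
    finally have "d w \<le> 4 * M" by simp
    hence "\<theta> * d w \<le> \<theta> * (4 * M)" using th(2) by (intro mult_left_mono) auto
    also have "\<dots> = e / 2" using th(1) by simp
    finally show ?thesis .
  qed
  \<comment> \<open>The lower bound holds for \<open>a u + b u\<close>; replacing \<open>a u\<close>
    by \<open>a v\<close> costs \<open>e\<close> by the choice of \<open>i\<close>.\<close>
  have sum_ab: "M - 2 * e \<le> a v + b u" using ab'[OF uW] i e2 by (simp add: v_def u_def)
  have av: "e \<le> a v" using sum_ab b_le[OF u] l e2 by linarith
  have T2: "\<theta> * d v \<le> card (T 2 v)"
  proof -
    \<comment> \<open>At most \<open>?n \<le> a v - e\<close> ancestors lie within distance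
      \<open>?n\<close>, so at least \<open>e\<close> of the neighbours among the near ancestors
      belong to \<open>T 2 v\<close>.\<close>
    let ?n = "nat \<lfloor>a v - e\<rfloor>"
    have "near_anc_nbrs E l p v \<subseteq> T 2 v \<union> (\<Union>j\<in>{1..?n}. set_option (ancestor p j v))"
    proof
      fix w assume w: "w \<in> near_anc_nbrs E l p v"
      then obtain j where j: "1 \<le> j" "j < l" "ancestor p j v = Some w" "w \<in> nbrs E v"
        by (auto simp: near_anc_nbrs_def)
      show "w \<in> T 2 v \<union> (\<Union>j\<in>{1..?n}. set_option (ancestor p j v))"
      proof (cases "a v - e \<le> j")
        case True
        hence "w \<in> T 2 v" using j by (auto simp: T_def targets_def a_def e_def M_def)
        thus ?thesis by simp
      next
        case False
        hence "j \<le> ?n" by linarith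
        thus ?thesis using j by auto
      qed
    qed
    moreover have "finite (T 2 v)" using targets_subset fN finite_subset unfolding T_def by metis
    ultimately have "card (near_anc_nbrs E l p v) \<le> card (T 2 v \<union> (\<Union>j\<in>{1..?n}. set_option (ancestor p j v)))"
      by (intro card_mono) auto
    also have "\<dots> \<le> card (T 2 v) + card (\<Union>j\<in>{1..?n}. set_option (ancestor p j v))"
      by (rule card_Un_le)
    also have "\<dots> \<le> card (T 2 v) + ?n" using card_anc[of "{1..?n}"] by simp
    finally have "a v \<le> card (T 2 v) + real ?n" unfolding a_def by linarith
    moreover have "real ?n \<le> a v - e" using av by linarith
    ultimately show ?thesis using d_le[OF v] e2 by linarith
  qed
  have T3: "\<theta> * d u \<le> card (T 3 u)"
  proof -
    \<comment> \<open>As \<open>u\<close> is not low, each level from \<open>?n\<close> to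
      \<open>l - 1\<close> below it is inhabited. As \<open>u\<close> is not heavy either, at most
      \<open>?n + e\<close> descendants remain in the first \<open>?n\<close> levels, and more than
      \<open>e - 1\<close> neighbours are left for \<open>T 3 u\<close>.\<close>
    let ?n = "nat \<lceil>b u - 2 * e\<rceil>"
    have n: "real ?n < b u - 2 * e + 1" using b_ge[OF uW] e2 by linarith
    have "?n \<le> l" using n b_le[OF u] e2 by linarith
    have "near_desc_nbrs E l p u \<subseteq> T 3 u \<union> near_desc ?n u"
    proof
      fix w assume w: "w \<in> near_desc_nbrs E l p u"
      then obtain j where j: "1 \<le> j" "j < l" "ancestor p j w = Some u" "w \<in> nbrs E u"
        by (auto simp: near_desc_nbrs_def)
      show "w \<in> T 3 u \<union> near_desc ?n u"
      proof (cases "b u - 2 * e \<le> j")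
        case True
        hence "w \<in> T 3 u" using j by (auto simp: T_def targets_def b_def e_def M_def)
        thus ?thesis by simp
      next
        case False
        hence "j < ?n" by linarith
        thus ?thesis using j by (auto simp: near_desc_def desc_def)
      qed
    qed
    moreover have "finite (T 3 u)" using targets_subset fN finite_subset unfolding T_def by metis
    ultimately have "card (near_desc_nbrs E l p u) \<le> card (T 3 u \<union> near_desc ?n u)"
      using u finite_near_desc by (intro card_mono) auto
    also have "\<dots> \<le> card (T 3 u) + card (near_desc ?n u)" by (rule card_Un_le)
    finally have 1: "b u \<le> card (T 3 u) + real (card (near_desc ?n u))" unfolding b_def by linarith
    have "(\<Sum>j\<in>{?n..<l}. 1) \<le> (\<Sum>j\<in>{?n..<l}. card (desc j u))"
      using card_desc_ge_1[OF ul] by (intro sum_mono) auto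
    moreover have "card (near_desc l u) = card (near_desc n u) + (\<Sum>j\<in>{n..<l}. card (desc j u))"
      if "n \<le> l" for n
    proof -
      have "{..<l} = {..<n} \<union> {n..<l}" using that by auto
      thus ?thesis using u by (simp add: card_near_desc sum.union_disjoint ivl_disj_int)
    qed
    note this[OF \<open>?n \<le> l\<close>]
    ultimately have "card (near_desc ?n u) + (l - ?n) \<le> card (near_desc l u)" by simp
    hence "real (card (near_desc ?n u)) \<le> e + ?n"
      using near_le[OF u] \<open>?n \<le> l\<close> by linarith
    thus ?thesis using 1 n d_le[OF u] e2 by linarith
  qed
  from hit[OF vW _ T2] obtain x where x: "x \<in> c v" "x \<in> T 2 v" by auto
  from hit[OF uW _ T3] obtain y where y: "y \<in> c u" "y \<in> T 3 u" by auto
  obtain j where j: "1 \<le> j" "ancestor p j v = Some x" "a v - e \<le> j"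
    using x by (auto simp: T_def targets_def a_def e_def M_def)
  obtain h where h: "1 \<le> h" "h < l" "ancestor p h y = Some u" "b u - 2 * e \<le> h"
    using y by (auto simp: T_def targets_def b_def e_def M_def)
  text \<open>At least \<open>l - 1\<close> of the at most \<open>l + e\<close> near descendants of \<open>u\<close> lie below \<open>v\<close>, which leaves
    no room for a long path from \<open>u\<close> to \<open>y\<close> avoiding \<open>v\<close>.\<close>
  have yv: "ancestor p (h - 1) y = Some v"
  proof (rule ccontr)
    assume neq: "ancestor p (h - 1) y \<noteq> Some v"
    obtain v' where v': "ancestor p (h - 1) y = Some v'" "p v' = Some u"
      using h ancestor_le_Some[of p h y u "h - 1"] by auto
    have ch: "distinct (chain y h)" using distinct_chain[OF v'(1)] h(1) by simp
    have disj: "near_desc (l - 1) v \<inter> set (chain y h) = {}"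
    proof (intro equals0I)
      fix z assume z: "z \<in> near_desc (l - 1) v \<inter> set (chain y h)"
      then obtain i1 where i1: "ancestor p i1 z = Some v" by (auto simp: near_desc_def desc_def)
      have "z \<in> set (chain y (Suc (h - 1)))" using z h by simp
      then obtain i2 where i2: "ancestor p i2 z = Some v'" using set_chain[OF v'(1)] by blast
      have "depth v = depth v'" using parent[OF pv] parent[OF v'(2)] by simp
      hence "i1 = i2" using ancestor_depth[OF i1] ancestor_depth[OF i2] by simp
      thus False using i1 i2 v' neq by simp
    qed
    have "set (chain y h) \<subseteq> near_desc l u"
    proof
      fix z assume "z \<in> set (chain y h)"
      hence "z \<in> set (chain y (Suc (h - 1)))" using h by simp
      then obtain i2 where "ancestor p (h - 1 - i2) z = Some v'" using set_chain[OF v'(1)] by blast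
      hence "ancestor p (Suc (h - 1 - i2)) z = Some u" using v' by simp
      moreover have "Suc (h - 1 - i2) < l" using h by linarith
      ultimately show "z \<in> near_desc l u" unfolding near_desc_def desc_def by blast
    qed
    moreover have "near_desc (l - 1) v \<subseteq> near_desc l u"
    proof
      fix z assume "z \<in> near_desc (l - 1) v"
      then obtain i1 where "i1 < l - 1" "ancestor p i1 z = Some v" by (auto simp: near_desc_def desc_def)
      hence "Suc i1 < l" "ancestor p (Suc i1) z = Some u" using pv by auto
      thus "z \<in> near_desc l u" unfolding near_desc_def desc_def by blast
    qed
    ultimately have "card (near_desc (l - 1) v \<union> set (chain y h)) \<le> card (near_desc l u)"
      using u finite_near_desc by (intro card_mono) auto
    also have "card (near_desc (l - 1) v \<union> set (chain y h)) = card (near_desc (l - 1) v) + h"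
      using disj v finite_near_desc ch by (subst card_Un_disjoint) (auto simp: distinct_card)
    finally have "l - 1 + h \<le> card (near_desc l u)"
      using card_near_desc_ge[OF vl, of "l - 1"] by linarith
    hence "real l - 1 + h \<le> l + e" using near_le[OF u] l1 by linarith
    thus False using h(4) b_ge[OF uW] e2 by linarith
  qed
  have ux: "ancestor p (j - 1) u = Some x"
    using j ancestor_Suc_Some[of p v u "j - 1"] pv by simp
  have len: "(1 - \<epsilon>) * m \<le> real (Suc (j - 1) + Suc (h - 1))"
  proof -
    have "(1 - \<epsilon>) * m = M - 10 * e" using eM by (simp add: M_def algebra_simps)
    \<comment> \<open>\<open>j + h\<close> is at least \<open>(a v - e) + (b u - 2 * e)\<close>,
      hence at least \<open>M - 5 * e\<close>.\<close>
    also have "\<dots> \<le> real j + real h" using j(3) h(4) sum_ab e2 by linarith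
    finally show ?thesis using j(1) h(1) by simp
  qed
  have "3 \<le> Suc (j - 1) + Suc (h - 1)" using h(4) b_ge[OF uW] e2 by linarith
  with cycle_two_chords[where H = H, OF H sym pv ux _ yv] cH x(1) y(1) u v len
  have "has_cycle_len_ge H ((1 - \<epsilon>) * m)" by blast
  thus False using no_cycle by simp
qed

end

section \<open>Transfer to the random graph\<close>

lemma cycle_of_good_choices:
  fixes \<epsilon> \<eta> \<theta> \<kappa> :: real and m t :: nat
  assumes G: "simple_graph V E" and "V \<noteq> {}" and deg: "\<And>v. v \<in> V \<Longrightarrow> m \<le> card (nbrs E v)"
    and c: "\<And>v. v \<in> V \<Longrightarrow> c v \<subseteq> nbrs E v"
    and eps: "0 < \<epsilon>" "\<epsilon> \<le> 1 / 2" and eta: "\<eta> = \<epsilon> / 10" and theta: "\<theta> = \<eta> / 8"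
    and t: "1 \<le> t * \<eta>" and m: "2 \<le> \<eta> * m" "2 * t \<le> m"
    and kappa: "real (t + 1) * (1 + (1 + 4 / \<epsilon>) * (1 + 1 / \<eta>)) * \<kappa> \<le> 1"
    and good: "c \<notin> bad_choices V E 4 (targets E (nat \<lceil>(1 - \<epsilon>) * m\<rceil>) (\<eta> * m)) (\<kappa> * \<theta>)"
  shows "has_cycle_len_ge (out_graph V c) ((1 - \<epsilon>) * m)"
proof -
  let ?T = "targets E (nat \<lceil>(1 - \<epsilon>) * m\<rceil>) (\<eta> * m)"
  have "0 < m" using m eps eta by (intro gr0I) auto
  hence ne: "nbrs E v \<noteq> {}" if "v \<in> V" for v using deg[OF that] by auto
  have NV: "nbrs E v \<subseteq> V" for v using G by (auto simp: simple_graph_def nbrs_def)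
  obtain p depth where F: "rooted_forest V p depth"
    and H: "\<And>x y. p x = Some y \<Longrightarrow> out_graph V c x y"
    and cmp: "\<And>x y. out_graph V c x y \<Longrightarrow> \<exists>j. ancestor p j x = Some y \<or> ancestor p j y = Some x"
    and W: "card {v \<in> V. \<exists>i<4. \<theta> * card (nbrs E v) \<le> card (?T p i v) \<and> c v \<inter> ?T p i v = {}} < \<kappa> * card V"
    using ex_forest_few_unlucky[OF G ne c targets_subset _ good] eps eta theta by auto
  interpret rooted_forest V p depth by fact
  have cH: "out_graph V c v w" if "v \<in> V" "w \<in> c v" for v w
    using that c NV by (fastforce simp: out_graph_def)
  have K: "0 < real (t + 1) * (1 + (1 + 4 / \<epsilon>) * (1 + 1 / \<eta>))"
    using eps eta by (intro mult_pos_pos add_pos_pos) auto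
  show ?thesis
  proof (rule cycle_of_lucky_forest[OF G \<open>V \<noteq> {}\<close> deg H _ cH eps eta theta t m])
    \<comment> \<open>A choice is an edge of the random graph, so its ends are comparable in the
      search forest, whereas the targets of index 0 are incomparable to \<open>v\<close>.\<close>
    show "c v \<inter> ?T p 0 v = {}" if "v \<in> V" for v
      using cmp[OF cH[OF that]] by (auto simp: targets_def)
    show "real (t + 1) * (1 + (1 + 4 / \<epsilon>) * (1 + 1 / \<eta>)) *
      card {v \<in> V. \<exists>i<4. \<theta> * card (nbrs E v) \<le> card (?T p i v) \<and> c v \<inter> ?T p i v = {}} < card V"
    proof -
      have "real (t + 1) * (1 + (1 + 4 / \<epsilon>) * (1 + 1 / \<eta>)) *
          card {v \<in> V. \<exists>i<4. \<theta> * card (nbrs E v) \<le> card (?T p i v) \<and> c v \<inter> ?T p i v = {}}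
          < real (t + 1) * (1 + (1 + 4 / \<epsilon>) * (1 + 1 / \<eta>)) * (\<kappa> * card V)"
        using W K by (rule mult_strict_left_mono)
      also have "\<dots> \<le> 1 * real (card V)"
        unfolding mult.assoc[symmetric] by (intro mult_right_mono kappa) simp
      finally show ?thesis by simp
    qed
  qed (auto simp: out_graph_def)
qed

lemma k_out_eq: "k_out V E k = map_pmf (out_graph V) (Pi_pmf V {} (choose_k E k))"
  by (simp add: k_out_def out_graph_def[abs_def])

text \<open>Outside \<open>bad_choices\<close> the deterministic argument yields the cycle. The
  factor 5 counts the labels: four target sets and the label without a requirement. By
  \<open>k \<le> m\<close> every vertex chooses a genuine \<open>k\<close>-set.\<close>

lemma prob_long_cycle_ge:
  fixes \<epsilon> \<eta> \<theta> \<kappa> :: real and m t :: nat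
  assumes G: "simple_graph V E" and "V \<noteq> {}" and deg: "\<And>v. v \<in> V \<Longrightarrow> m \<le> card (nbrs E v)"
    and eps: "0 < \<epsilon>" "\<epsilon> \<le> 1 / 2" and eta: "\<eta> = \<epsilon> / 10" and theta: "\<theta> = \<eta> / 8"
    and t: "1 \<le> t * \<eta>" and m: "2 \<le> \<eta> * m" "2 * t \<le> m"
    and kappa: "real (t + 1) * (1 + (1 + 4 / \<epsilon>) * (1 + 1 / \<eta>)) * \<kappa> \<le> 1"
    and k: "0 < k" "k \<le> m"
  shows "1 - (5 * (1 + 2 * (exp 1 * k)) * exp (- (\<kappa> * \<theta>) * k)) ^ card V
    \<le> measure_pmf.prob (k_out V E k) {H. has_cycle_len_ge H ((1 - \<epsilon>) * m)}"
proof -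
  let ?M = "Pi_pmf V {} (choose_k E k)"
  let ?T = "targets E (nat \<lceil>(1 - \<epsilon>) * m\<rceil>) (\<eta> * m)"
  let ?bad = "bad_choices V E 4 ?T (\<kappa> * \<theta>)"
  let ?S = "{c. has_cycle_len_ge (out_graph V c) ((1 - \<epsilon>) * m)}"
  have fV: "finite V" using G by (simp add: simple_graph_def)
  have fN: "finite (nbrs E v)" for v
    using G by (auto simp: simple_graph_def nbrs_def intro: finite_subset[of _ V])
  have degk: "k \<le> card (nbrs E v)" if "v \<in> V" for v using deg[OF that] k by simp
  have supp: "c v \<subseteq> nbrs E v" if "c \<in> set_pmf ?M" "v \<in> V" for c v
  proof -
    have "c v \<in> set_pmf (choose_k E k v)"
      using that fV by (auto simp: set_Pi_pmf PiE_dflt_def)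
    moreover have "{S. S \<subseteq> nbrs E v \<and> card S = k} \<noteq> {}"
      using obtain_subset_with_card_n[OF degk[OF that(2)]] by blast
    ultimately show ?thesis
      using degk[OF that(2)] fN by (simp add: choose_k_def set_pmf_of_set)
  qed
  have bad: "measure_pmf.prob ?M ?bad \<le> (5 * (1 + 2 * (exp 1 * k)) * exp (- (\<kappa> * \<theta>) * k)) ^ card V"
    unfolding bad_choices_def
    using prob_certificate_le[OF G k(1) degk, of 5
        "\<lambda>g i v. if i < 4 then ?T (parent_of V g) i v else {}" "\<kappa> * \<theta>"] by simp
  have "1 - measure_pmf.prob ?M ?bad = measure_pmf.prob ?M (- ?bad)"
    using measure_pmf.prob_compl[of ?bad ?M] by (simp add: Compl_eq_Diff_UNIV)
  \<comment> \<open>Passing to the support ensures that every \<open>c v\<close> consists of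
    neighbours of \<open>v\<close>.\<close>
  also have "\<dots> = measure_pmf.prob ?M (- ?bad \<inter> set_pmf ?M)" by (simp add: measure_Int_set_pmf)
  also have "\<dots> \<le> measure_pmf.prob ?M ?S"
    using cycle_of_good_choices[OF G \<open>V \<noteq> {}\<close> deg _ eps eta theta t m kappa] supp
    by (intro measure_pmf.finite_measure_mono) auto
  also have "\<dots> = measure_pmf.prob (k_out V E k) {H. has_cycle_len_ge H ((1 - \<epsilon>) * m)}"
    by (simp add: k_out_eq vimage_def)
  finally show ?thesis using bad by linarith
qed

lemma exp_beats_linear:
  fixes \<delta> :: real
  assumes "\<delta> > 0"
  obtains K :: nat where "0 < K" "\<And>k. K \<le> k \<Longrightarrow> 5 * (1 + 2 * (exp 1 * k)) * exp (- \<delta> * k) \<le> 1 / 2"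
proof
  \<comment> \<open>Since \<open>exp 1 \<le> 3\<close> and \<open>1 \<le> k\<close>, twice the
    linear factor is at most \<open>70 * k = 140 * k / 2\<close>, which the quadratic term
    \<open>(\<delta> * k) ^ 2 / 2\<close> of the exponential dominates once
    \<open>140 \<le> \<delta> ^ 2 * k\<close>.\<close>
  let ?K = "nat \<lceil>140 / \<delta>\<^sup>2\<rceil>"
  have K: "140 / \<delta>\<^sup>2 \<le> ?K" by linarith
  have "0 < 140 / \<delta>\<^sup>2" using assms by simp
  thus K0: "0 < ?K" by linarith
  fix k assume "?K \<le> k"
  hence k: "140 / \<delta>\<^sup>2 \<le> k" "1 \<le> k" using K K0 by linarith+
  have "10 * (1 + 2 * (exp 1 * k)) \<le> 10 * (real k + 2 * (3 * real k))"
    using k exp_le by (intro mult_left_mono add_mono mult_right_mono) auto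
  also have "\<dots> = 140 * k / 2" by simp
  also have "\<dots> \<le> (\<delta>\<^sup>2 * k) * k / 2"
    using k assms by (intro divide_right_mono mult_right_mono) (auto simp: field_simps)
  also have "\<dots> = (\<delta> * k)\<^sup>2 / 2" by (simp add: power2_eq_square)
  also have "\<dots> \<le> exp (\<delta> * k)" 
    using exp_lower_Taylor_quadratic[of "\<delta> * k"] mult_nonneg_nonneg[of \<delta> k] assms by linarith
  finally show "5 * (1 + 2 * (exp 1 * k)) * exp (- \<delta> * k) \<le> 1 / 2"
    by (simp add: exp_minus field_simps)
qed

lemma has_cycle_len_ge_mono: "has_cycle_len_ge H L \<Longrightarrow> L' \<le> L \<Longrightarrow> has_cycle_len_ge H L'"
  unfolding has_cycle_len_ge_def by (meson order_trans)

theorem theorem4: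
  fixes V :: "nat \<Rightarrow> nat set" and E :: "nat \<Rightarrow> nat \<Rightarrow> nat \<Rightarrow> bool"
  assumes graphs: "\<And>i. simple_graph (V i) (E i)"
    and n_to_inf: "filterlim (\<lambda>i. card (V i)) at_top sequentially"
    and m_to_inf: "filterlim (\<lambda>i. min_degree (V i) (E i)) at_top sequentially"
  shows "\<forall>\<epsilon>::real. \<epsilon> > 0 \<longrightarrow> (\<exists>k\<^sub>\<epsilon>::nat. k\<^sub>\<epsilon> > 0 \<and> (\<forall>k\<ge>k\<^sub>\<epsilon>.
           (\<lambda>i. measure_pmf.prob (k_out (V i) (E i) k)
                  {H. has_cycle_len_ge H ((1 - \<epsilon>) * real (min_degree (V i) (E i)))})
           \<longlonglongrightarrow> 1))"
proof (intro allI impI)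
  fix \<epsilon>0 :: real assume "\<epsilon>0 > 0"
  \<comment> \<open>Capping at 1/2 is harmless: a larger \<open>\<epsilon>0\<close> only weakens the
    demand on the cycle length.\<close>
  define \<epsilon> where "\<epsilon> = min \<epsilon>0 (1 / 2)"
  have eps: "0 < \<epsilon>" "\<epsilon> \<le> 1 / 2" "\<epsilon> \<le> \<epsilon>0" using \<open>\<epsilon>0 > 0\<close> by (auto simp: \<epsilon>_def)
  define \<eta> where "\<eta> = \<epsilon> / 10"
  define \<theta> where "\<theta> = \<eta> / 8"
  \<comment> \<open>\<open>t\<close> increments of \<open>\<eta> * m\<close> add up to at least
    \<open>m\<close>, which is the chain length required.\<close>
  define t where "t = nat \<lceil>1 / \<eta>\<rceil>"
  define \<kappa> where "\<kappa> = 1 / (real (t + 1) * (1 + (1 + 4 / \<epsilon>) * (1 + 1 / \<eta>)))"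
  have pos: "0 < \<eta>" "0 < \<theta>" using eps by (simp_all add: \<eta>_def \<theta>_def)
  have K: "0 < real (t + 1) * (1 + (1 + 4 / \<epsilon>) * (1 + 1 / \<eta>))"
    using eps pos by (intro mult_pos_pos add_pos_pos) auto
  have kappa: "real (t + 1) * (1 + (1 + 4 / \<epsilon>) * (1 + 1 / \<eta>)) * \<kappa> \<le> 1" "0 < \<kappa>"
    using K unfolding \<kappa>_def by simp_all
  have "1 / \<eta> \<le> t" unfolding t_def by linarith
  hence t: "1 \<le> t * \<eta>" using pos by (simp add: field_simps)
  \<comment> \<open>\<open>\<kappa>\<close> and \<open>\<theta>\<close> depend only on
    \<open>\<epsilon>\<close>, hence so does \<open>k0\<close>.\<close>
  obtain k0 :: nat where k0: "0 < k0"
    "\<And>k. k0 \<le> k \<Longrightarrow> 5 * (1 + 2 * (exp 1 * k)) * exp (- (\<kappa> * \<theta>) * k) \<le> 1 / 2"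
    using exp_beats_linear[of "\<kappa> * \<theta>"] kappa pos by (metis mult_pos_pos)
  show "\<exists>k\<^sub>\<epsilon>::nat. k\<^sub>\<epsilon> > 0 \<and> (\<forall>k\<ge>k\<^sub>\<epsilon>.
           (\<lambda>i. measure_pmf.prob (k_out (V i) (E i) k)
                  {H. has_cycle_len_ge H ((1 - \<epsilon>0) * real (min_degree (V i) (E i)))})
           \<longlonglongrightarrow> 1)"
  proof (intro exI[of _ k0] conjI allI impI)
    fix k assume k: "k0 \<le> k"
    let ?m = "\<lambda>i. min_degree (V i) (E i)"
    let ?P = "\<lambda>i. measure_pmf.prob (k_out (V i) (E i) k) {H. has_cycle_len_ge H ((1 - \<epsilon>0) * ?m i)}"
    \<comment> \<open>From minimum degree \<open>m0\<close> on, every vertex has \<open>k\<close>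
      neighbours to choose from, \<open>\<eta> * m\<close> absorbs the rounding errors, and the
      chain is short compared with \<open>m\<close>.\<close>
    define m0 where "m0 = max k (max (nat \<lceil>2 / \<eta>\<rceil>) (2 * t))"
    have "eventually (\<lambda>i. 1 \<le> card (V i)) sequentially" "eventually (\<lambda>i. m0 \<le> ?m i) sequentially"
      using n_to_inf m_to_inf by (simp_all add: filterlim_at_top)
    hence "eventually (\<lambda>i. 1 - (1 / 2) ^ card (V i) \<le> ?P i) sequentially"
    proof eventually_elim
      case (elim i)
      have fV: "finite (V i)" "V i \<noteq> {}" using elim graphs[of i] by (auto simp: simple_graph_def)
      have deg: "?m i \<le> card (nbrs (E i) v)" if "v \<in> V i" for v
        using that fV unfolding min_degree_def by (intro Min_le) auto
      have "2 / \<eta> \<le> ?m i" using elim unfolding m0_def by linarith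
      hence m: "2 \<le> \<eta> * ?m i" "2 * t \<le> ?m i" "k \<le> ?m i"
        using elim pos by (auto simp: m0_def field_simps)
      have k': "0 < k" using k k0 by simp
      have "1 - (1 / 2) ^ card (V i) \<le> 1 - (5 * (1 + 2 * (exp 1 * k)) * exp (- (\<kappa> * \<theta>) * k)) ^ card (V i)"
        using k0(2)[OF k] by (intro diff_left_mono power_mono) auto
      also have "\<dots> \<le> measure_pmf.prob (k_out (V i) (E i) k) {H. has_cycle_len_ge H ((1 - \<epsilon>) * ?m i)}"
        using prob_long_cycle_ge[OF graphs fV(2) deg eps(1,2) \<eta>_def \<theta>_def t m(1,2) kappa(1) k' m(3)] .
      also have "\<dots> \<le> ?P i"
        using eps(3) by (intro measure_pmf.finite_measure_mono)
          (auto intro!: mult_right_mono elim!: has_cycle_len_ge_mono)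
      finally show ?case .
    qed
    moreover have "(\<lambda>i. 1 - (1 / 2 :: real) ^ card (V i)) \<longlonglongrightarrow> 1 - 0"
      by (intro tendsto_diff tendsto_const filterlim_compose[OF LIMSEQ_power_zero n_to_inf]) simp
    ultimately show "?P \<longlonglongrightarrow> 1"
      by (intro tendsto_sandwich[of "\<lambda>i. 1 - (1 / 2) ^ card (V i)" ?P sequentially "\<lambda>_. 1" 1]) auto
  qed (fact k0)
qed

end
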